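(* Let $q\in(2,\infty)$. (1) Let $p\in[2,q)$ and let $Y$ be a $p$-uniformly convex Banach space. There is a constant $\alpha>0$ depending only on $p,q,Y$ such that for every $D\ge1$ and every $n\in\mathbb{N}$ there exists an $n$-point subset $\mathcal{L}_n(q,D,Y)$ of $\ell_q$ that is $2^{32}$-doubling and such that, if it admits a bi-Lipschitz embedding with distortion $D$ into $Y$, then $D\ge\alpha(\log n)^{\frac1p-\frac1q}$. (2) There is a constant $\alpha>0$ depending only on $q$ such that for every $d\in\mathbb{N}$ (with $d\ge 1$), every $D\ge1$ and every $n\in\mathbb{N}$ there exists an $n$-point subset $\mathcal{L}_n(q,D,\ell_q^d)$ of $\ell_q$ that is $2^{32}$-doubling and such that, if it admits a bi-Lipschitz embedding with distortion $D$ into $\ell_q^d$, then $D\ge\alpha\left(\frac{\log n}{d}\right)^{\frac12-\frac1q}$.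
   Context: A metric space is $\lambda$-doubling if every ball can be covered by at most $\lambda$ balls of half the radius. A map $f:(X,d_X)\to(Y,d_Y)$ is a bi-Lipschitz embedding with distortion $D$ if there is $r>0$ with $r\,d_X(x,y)\le d_Y(f(x),f(y))\le rD\,d_X(x,y)$ for all $x,y\in X$. Subsets of $\ell_q$ carry the metric induced by the $\ell_q$-norm; $\ell_q^d$ is $\mathbb{R}^d$ with the $\ell_q$-norm; $\mathbb{N}=\{1,2,\dots\}$. A Banach space $Y$ is $p$-uniformly convex if there is $c>0$ such that $\delta_Y(t)\ge ct^p$ for all $t\in(0,2]$, where $\delta_Y(t)=\inf\{1-\|\frac{x+y}{2}\| : x,y\in Y,\ \|x\|=\|y\|=1,\ \|x-y\|\ge t\}$. *)

theory Defs
  imports "HOL-Analysis.Analysis"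
begin

text \<open>The real sequence space \<open>\<ell>\<^sub>q\<close>, as a carrier set because \<open>q\<close> is a term-level parameter.\<close>

definition lq :: "real \<Rightarrow> (nat \<Rightarrow> real) set" where
  "lq q = {x. summable (\<lambda>i. \<bar>x i\<bar> powr q)}"

definition lq_norm :: "real \<Rightarrow> (nat \<Rightarrow> real) \<Rightarrow> real" where
  "lq_norm q x = (\<Sum>i. \<bar>x i\<bar> powr q) powr (1 / q)"

definition lq_dist :: "real \<Rightarrow> (nat \<Rightarrow> real) \<Rightarrow> (nat \<Rightarrow> real) \<Rightarrow> real" where
  "lq_dist q x y = lq_norm q (\<lambda>i. x i - y i)"

text \<open>The space \<open>\<ell>\<^sub>q\<^sup>d\<close>: the dimension \<open>d\<close> is quantified inside formulas, so \<open>\<real>\<^sup>d\<close> is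
  represented by the extensional functions on \<open>{..<d}\<close>.\<close>

definition lq_fin :: "nat \<Rightarrow> (nat \<Rightarrow> real) set" where
  "lq_fin d = ({..<d} \<rightarrow>\<^sub>E UNIV)"

definition lq_fin_norm :: "real \<Rightarrow> nat \<Rightarrow> (nat \<Rightarrow> real) \<Rightarrow> real" where
  "lq_fin_norm q d x = (\<Sum>i<d. \<bar>x i\<bar> powr q) powr (1 / q)"

definition lq_fin_dist :: "real \<Rightarrow> nat \<Rightarrow> (nat \<Rightarrow> real) \<Rightarrow> (nat \<Rightarrow> real) \<Rightarrow> real" where
  "lq_fin_dist q d x y = lq_fin_norm q d (\<lambda>i. x i - y i)"

text \<open>Balls are closed balls of the space \<open>M\<close> itself, with centres in \<open>M\<close>.  For finite \<open>M\<close>,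
  open balls give the same notion.\<close>

definition doubling :: "nat \<Rightarrow> 'a set \<Rightarrow> ('a \<Rightarrow> 'a \<Rightarrow> real) \<Rightarrow> bool" where
  "doubling N M d \<longleftrightarrow>
    (\<forall>x\<in>M. \<forall>r>0. \<exists>C\<subseteq>M. finite C \<and> card C \<le> N \<and>
      Metric_space.mcball M d x r \<subseteq> (\<Union>c\<in>C. Metric_space.mcball M d c (r / 2)))"

definition bi_Lipschitz_embedding ::
  "'a set \<Rightarrow> ('a \<Rightarrow> 'a \<Rightarrow> real) \<Rightarrow> 'b set \<Rightarrow> ('b \<Rightarrow> 'b \<Rightarrow> real) \<Rightarrow> real \<Rightarrow> ('a \<Rightarrow> 'b) \<Rightarrow> bool" where
  "bi_Lipschitz_embedding X dX Y dY D f \<longleftrightarrow>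
    f ` X \<subseteq> Y \<and>
    (\<exists>r>0. \<forall>x\<in>X. \<forall>y\<in>X. r * dX x y \<le> dY (f x) (f y) \<and> dY (f x) (f y) \<le> r * D * dX x y)"

text \<open>The modulus of convexity is \<open>ereal\<close>-valued so that the infimum over the empty set, which
  occurs for the zero space, is \<open>\<infinity>\<close>.\<close>

definition modulus_of_convexity :: "'a::real_normed_vector itself \<Rightarrow> real \<Rightarrow> ereal" where
  "modulus_of_convexity Y t =
    Inf {ereal (1 - norm ((x + y) /\<^sub>R 2)) | x y :: 'a.
      norm x = 1 \<and> norm y = 1 \<and> t \<le> norm (x - y)}"

definition uniformly_convex :: "real \<Rightarrow> 'a::real_normed_vector itself \<Rightarrow> bool" where
  "uniformly_convex p Y \<longleftrightarrow>
    (\<exists>c>0. \<forall>t. 0 < t \<and> t \<le> 2 \<longrightarrow> ereal (c * t powr p) \<le> modulus_of_convexity Y t)"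

end

theory Submission
  imports Defs
begin

text \<open>
  For \<open>k \<ge> 1\<close> put \<open>\<delta> = k\<^bsup>-1/q\<^esup>\<close> and consider all points \<open>w\<close> with \<open>w 0 = x \<in> \<real>\<close> and
  \<open>w i = \<plusminus> \<delta> 4\<^bsup>-i\<^esup> g (4\<^sup>i x)\<close> for \<open>1 \<le> i \<le> k\<close>, with arbitrary signs, where \<open>g\<close> is the distance to the
  nearest odd integer.  Restricted to \<open>x \<in> 4\<^bsup>-k\<^esup>\<int> \<inter> [0, 1]\<close> they contain a thin Laakso graph: an edge
  \<open>s t\<close> of level \<open>i\<close> is replaced by a path \<open>s a b c t\<close> together with a second midpoint \<open>b'\<close> at distance
  \<open>2 \<delta> 4\<^bsup>-i-1\<^esup>\<close> from \<open>b\<close>.  As \<open>k \<delta>\<^sup>q = 1\<close>, all edges keep length at most twice their projection to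
  the \<open>x\<close>-axis.

  Doubling: in a ball of radius \<open>r\<close> around \<open>z\<close>, the sign at level \<open>i\<close> can vary only if \<open>z 0\<close> is within
  \<open>r / \<delta>\<close> of an odd multiple of \<open>4\<^bsup>-i\<^esup>\<close>.  Odd multiples for different levels are far apart, so a
  bounded number of levels is relevant before the amplitude \<open>\<delta> 4\<^bsup>-i\<^esup>\<close> drops below \<open>r\<close>.

  Distortion: uniform convexity, applied to the diamond \<open>a b c b'\<close>, makes the normalised length of
  the images of edges drop by a definite amount, of order \<open>D (\<delta> / D)\<^sup>p\<close>, from level \<open>i + 1\<close> to level \<open>i\<close>.
  After \<open>k\<close> levels, \<open>k (\<delta> / D)\<^sup>p\<close> is bounded, that is, \<open>D\<close> is at least of order \<open>k\<^bsup>1/p - 1/q\<^esup>\<close>.  For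
  \<open>\<ell>\<^sub>q\<^sup>d\<close> one passes to \<open>\<ell>\<^sub>2\<^sup>d\<close>, at the cost of a factor \<open>d\<^bsup>1/2 - 1/q\<^esup>\<close> in \<open>D\<close>.
\<close>

section \<open>Inequalities for powers and norms\<close>

text \<open>A convex function lies above its tangent at 1. The point \<open>t = 0\<close> is treated
  apart because convexity is used on the open half-line.\<close>

lemma powr_ge_tangent_at_1:
  fixes p t :: real
  assumes "1 \<le> p" "0 \<le> t"
  shows "1 + p * (t - 1) \<le> t powr p"
proof (cases "t = 0")
  case False
  then have t: "t > 0" using assms by simp
  have "t powr p - 1 powr p \<ge> p * (t - 1)"
  proof (rule convex_on_imp_above_tangent[where A="{0<..}"])
    show "convex_on {0<..} (\<lambda>x. x powr p)" by (rule powr_convex) (use assms in simp)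
    show "((\<lambda>x. x powr p) has_real_derivative p) (at 1 within {0<..})"
      by (auto intro!: derivative_eq_intros)
  qed (use t in \<open>auto simp: interior_open\<close>)
  then show ?thesis by simp
qed (use assms in auto)

text \<open>The tangent inequality, rescaled to the mean \<open>m\<close>, is applied at
  \<open>u\<close> and at \<open>v\<close>; in the weighted average the linear terms cancel.\<close>

lemma powr_convex_combination:
  fixes p u v a b :: real
  assumes "1 \<le> p" "0 \<le> u" "0 \<le> v" "0 \<le> a" "0 \<le> b" "a + b = 1"
  shows "(a * u + b * v) powr p \<le> a * u powr p + b * v powr p"
proof (cases "a * u + b * v = 0")
  case True
  then show ?thesis using assms by simp
next
  case False
  define m where "m = a * u + b * v"
  have m: "m > 0" using False assms unfolding m_def by (metis add_nonneg_nonneg mult_nonneg_nonneg order_le_less)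
  have tan: "m powr p * (1 + p * (w / m - 1)) \<le> w powr p" if "w \<ge> 0" for w
  proof -
    have "m powr p * (1 + p * (w / m - 1)) \<le> m powr p * (w / m) powr p"
      by (rule mult_left_mono[OF powr_ge_tangent_at_1]) (use assms m that in auto)
    also have "\<dots> = w powr p" using m that by (simp add: powr_divide)
    finally show ?thesis .
  qed
  have "m powr p = m powr p * (1 + p * (m / m - 1))" using m by simp
  also have "m / m = a * (u / m) + b * (v / m)" using m by (simp add: m_def add_divide_distrib[symmetric])
  also have "m powr p * (1 + p * (a * (u / m) + b * (v / m) - 1))
      = a * (m powr p * (1 + p * (u / m - 1))) + b * (m powr p * (1 + p * (v / m - 1)))"
  proof -
    have b: "b = 1 - a" using assms by simp
    show ?thesis unfolding b by algebra
  qed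
  also have "\<dots> \<le> a * u powr p + b * v powr p"
    by (intro add_mono mult_left_mono tan) (use assms in auto)
  finally show ?thesis by (simp add: m_def)
qed

text \<open>Normalise \<open>x\<close> and \<open>y\<close> by their norms \<open>a\<close> and
  \<open>b\<close>, then apply convexity termwise with weights \<open>a / (a + b)\<close> and
  \<open>b / (a + b)\<close>.\<close>

lemma Minkowski_sum:
  fixes x y :: "'b \<Rightarrow> real"
  assumes p: "1 \<le> p"
  shows "(\<Sum>i\<in>I. \<bar>x i + y i\<bar> powr p) powr (1 / p)
    \<le> (\<Sum>i\<in>I. \<bar>x i\<bar> powr p) powr (1 / p) + (\<Sum>i\<in>I. \<bar>y i\<bar> powr p) powr (1 / p)"
proof (cases "finite I")
  case fin: True
  define a where "a = (\<Sum>i\<in>I. \<bar>x i\<bar> powr p) powr (1 / p)"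
  define b where "b = (\<Sum>i\<in>I. \<bar>y i\<bar> powr p) powr (1 / p)"
  have ap: "(\<Sum>i\<in>I. \<bar>x i\<bar> powr p) = a powr p" and bp: "(\<Sum>i\<in>I. \<bar>y i\<bar> powr p) = b powr p"
    using p by (auto simp: a_def b_def powr_powr sum_nonneg)
  have nn: "a \<ge> 0" "b \<ge> 0" by (auto simp: a_def b_def)
  have "(\<Sum>i\<in>I. \<bar>x i + y i\<bar> powr p) \<le> (a + b) powr p"
  proof (cases "a = 0 \<or> b = 0")
    case True
    then show ?thesis
    proof
      assume "a = 0"
      then have "\<forall>i\<in>I. x i = 0" using ap fin by (simp add: sum_nonneg_eq_0_iff)
      then show ?thesis using bp \<open>a = 0\<close> by simp
    next
      assume "b = 0"
      then have "\<forall>i\<in>I. y i = 0" using bp fin by (simp add: sum_nonneg_eq_0_iff)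
      then show ?thesis using ap \<open>b = 0\<close> by simp
    qed
  next
    case False
    then have pos: "a > 0" "b > 0" using nn by auto
    have "(\<Sum>i\<in>I. \<bar>x i + y i\<bar> powr p)
       \<le> (\<Sum>i\<in>I. (a + b) powr p * (a / (a + b) * (\<bar>x i\<bar> powr p / a powr p) + b / (a + b) * (\<bar>y i\<bar> powr p / b powr p)))"
    proof (rule sum_mono)
      fix i
      have "\<bar>x i + y i\<bar> powr p \<le> (\<bar>x i\<bar> + \<bar>y i\<bar>) powr p"
        by (rule powr_mono2) (use p in auto)
      also have "\<bar>x i\<bar> + \<bar>y i\<bar> = (a + b) * (a / (a + b) * (\<bar>x i\<bar> / a) + b / (a + b) * (\<bar>y i\<bar> / b))"
      proof -
        have "a / (a + b) * (\<bar>x i\<bar> / a) + b / (a + b) * (\<bar>y i\<bar> / b) = (\<bar>x i\<bar> + \<bar>y i\<bar>) / (a + b)"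
          using pos by (simp add: add_divide_distrib)
        then show ?thesis using pos by simp
      qed
      also have "\<dots> powr p = (a + b) powr p * (a / (a + b) * (\<bar>x i\<bar> / a) + b / (a + b) * (\<bar>y i\<bar> / b)) powr p"
        using pos by (subst powr_mult) auto
      also have "\<dots> \<le> (a + b) powr p * (a / (a + b) * (\<bar>x i\<bar> / a) powr p + b / (a + b) * (\<bar>y i\<bar> / b) powr p)"
        by (intro mult_left_mono powr_convex_combination)
           (use p pos in \<open>auto simp: add_divide_distrib[symmetric]\<close>)
      finally show "\<bar>x i + y i\<bar> powr p \<le> (a + b) powr p * (a / (a + b) * (\<bar>x i\<bar> powr p / a powr p) + b / (a + b) * (\<bar>y i\<bar> powr p / b powr p))"
        using pos by (simp add: powr_divide)
    qed
    also have "\<dots> = (a + b) powr p * (a / (a + b) * ((\<Sum>i\<in>I. \<bar>x i\<bar> powr p) / a powr p)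
        + b / (a + b) * ((\<Sum>i\<in>I. \<bar>y i\<bar> powr p) / b powr p))"
      by (simp only: sum.distrib sum_distrib_left[symmetric] sum_divide_distrib[symmetric])
    also have "\<dots> = (a + b) powr p"
      unfolding ap bp using pos by (simp add: add_divide_distrib[symmetric])
    finally show ?thesis .
  qed
  then have "(\<Sum>i\<in>I. \<bar>x i + y i\<bar> powr p) powr (1 / p) \<le> ((a + b) powr p) powr (1 / p)"
    by (intro powr_mono2) (use p in \<open>auto intro: sum_nonneg\<close>)
  also have "\<dots> = a + b" using nn p by (simp add: powr_powr)
  finally show ?thesis by (simp add: a_def b_def)
qed simp

text \<open>Power mean inequality: the tangent bound for the exponent \<open>q / 2\<close> at the
  mean \<open>m\<close> of the squares, summed over \<open>I\<close>.\<close>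

lemma L2_set_le_lq_sum:
  fixes x :: "'b \<Rightarrow> real"
  assumes q: "2 \<le> q" and I: "finite I" "I \<noteq> {}"
  shows "L2_set x I \<le> real (card I) powr (1 / 2 - 1 / q) * (\<Sum>i\<in>I. \<bar>x i\<bar> powr q) powr (1 / q)"
proof (cases "(\<Sum>i\<in>I. (x i)\<^sup>2) = 0")
  case True
  then show ?thesis by (simp add: L2_set_def)
next
  case False
  define d where "d = real (card I)"
  define m where "m = (\<Sum>i\<in>I. (x i)\<^sup>2) / d"
  have d: "d > 0" using I by (simp add: d_def card_gt_0_iff)
  have "(\<Sum>i\<in>I. (x i)\<^sup>2) > 0" using False by (simp add: less_le sum_nonneg)
  then have m: "m > 0" using d by (simp add: m_def)
  have sq: "\<bar>x i\<bar> powr q = ((x i)\<^sup>2) powr (q / 2)" for i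
  proof (cases "x i = 0")
    case False
    then have "(x i)\<^sup>2 = \<bar>x i\<bar> powr 2" by simp
    then show ?thesis by (simp only: powr_powr) simp
  qed simp
  have "d * m powr (q/2) = (\<Sum>i\<in>I. m powr (q/2) * (1 + q / 2 * ((x i)\<^sup>2 / m - 1)))"
  proof -
    have "(\<Sum>i\<in>I. (x i)\<^sup>2 / m) = d" using m d False by (simp only: sum_divide_distrib[symmetric]) (simp add: m_def)
    then have "(\<Sum>i\<in>I. 1 + q / 2 * ((x i)\<^sup>2 / m - 1)) = d"
      by (simp only: sum.distrib sum_distrib_left[symmetric] sum_subtractf) (simp add: d_def)
    then show ?thesis by (simp only: sum_distrib_left[symmetric]) simp
  qed
  also have "\<dots> \<le> (\<Sum>i\<in>I. \<bar>x i\<bar> powr q)"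
  proof (rule sum_mono)
    fix i
    have "m powr (q/2) * (1 + q / 2 * ((x i)\<^sup>2 / m - 1)) \<le> m powr (q/2) * ((x i)\<^sup>2 / m) powr (q/2)"
      by (intro mult_left_mono powr_ge_tangent_at_1) (use q m in auto)
    then show "m powr (q/2) * (1 + q / 2 * ((x i)\<^sup>2 / m - 1)) \<le> \<bar>x i\<bar> powr q"
      using m by (simp add: sq powr_divide)
  qed
  finally have "(d * m powr (q/2)) powr (1 / q) \<le> (\<Sum>i\<in>I. \<bar>x i\<bar> powr q) powr (1 / q)"
    by (intro powr_mono2) (use q d in auto)
  then have "d powr (1/q) * m powr (1/2) \<le> (\<Sum>i\<in>I. \<bar>x i\<bar> powr q) powr (1 / q)"
    using d q by (simp add: powr_mult powr_powr)
  then have "d powr (1/2 - 1/q) * (d powr (1/q) * m powr (1/2)) \<le> d powr (1/2 - 1/q) * (\<Sum>i\<in>I. \<bar>x i\<bar> powr q) powr (1 / q)"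
    by (rule mult_left_mono) simp
  moreover have "d powr (1/2 - 1/q) * (d powr (1/q) * m powr (1/2)) = (d * m) powr (1/2)"
    using d m by (simp add: powr_mult mult.assoc[symmetric] powr_add[symmetric])
  moreover have "(d * m) powr (1/2) = L2_set x I"
    using d by (simp add: m_def L2_set_def powr_half_sqrt sum_nonneg)
  ultimately show ?thesis by (simp add: d_def)
qed

text \<open>After division by the Euclidean norm all coordinates are at most 1 in modulus, so their
  \<open>q\<close>-th powers are at most their squares.\<close>

lemma lq_sum_le_L2_set:
  fixes x :: "'b \<Rightarrow> real"
  assumes q: "2 \<le> q" and I: "finite I"
  shows "(\<Sum>i\<in>I. \<bar>x i\<bar> powr q) powr (1 / q) \<le> L2_set x I"
proof (cases "L2_set x I = 0")
  case True
  then show ?thesis using I by (simp add: L2_set_eq_0_iff)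
next
  case False
  define s where "s = L2_set x I"
  have s: "s > 0" using False by (simp add: s_def order_less_le)
  have "(\<Sum>i\<in>I. \<bar>x i\<bar> powr q) \<le> (\<Sum>i\<in>I. s powr q * ((x i)\<^sup>2 / s\<^sup>2))"
  proof (rule sum_mono)
    fix i assume i: "i \<in> I"
    have le: "\<bar>x i\<bar> \<le> s"
      using member_le_L2_set[OF I i, of x] member_le_L2_set[OF I i, of "\<lambda>i. - x i"]
      by (simp add: s_def L2_set_def)
    have "\<bar>x i\<bar> powr q = s powr q * (\<bar>x i\<bar> / s) powr q" using s by (simp add: powr_divide)
    also have "(\<bar>x i\<bar> / s) powr q \<le> (\<bar>x i\<bar> / s) powr 2"
      by (rule powr_mono') (use q s le in auto)
    also have "(\<bar>x i\<bar> / s) powr 2 = (x i)\<^sup>2 / s\<^sup>2"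
      using s by (simp add: power_divide)
    finally show "\<bar>x i\<bar> powr q \<le> s powr q * ((x i)\<^sup>2 / s\<^sup>2)" by (simp add: mult_left_mono)
  qed
  also have "\<dots> = s powr q"
  proof -
    have "(\<Sum>i\<in>I. (x i)\<^sup>2) = s\<^sup>2" by (simp add: s_def L2_set_def sum_nonneg)
    then have "(\<Sum>i\<in>I. (x i)\<^sup>2 / s\<^sup>2) = 1"
      using s by (simp add: sum_divide_distrib[symmetric])
    then show ?thesis by (simp only: sum_distrib_left[symmetric])
  qed
  finally have "(\<Sum>i\<in>I. \<bar>x i\<bar> powr q) powr (1/q) \<le> (s powr q) powr (1/q)"
    by (intro powr_mono2) (use q in \<open>auto intro: sum_nonneg\<close>)
  then show ?thesis using s q by (simp add: powr_powr s_def)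
qed

text \<open>Passes from the unit sphere to the unit ball. If the shorter vector has norm at most
  \<open>1 - t / 4\<close>, the triangle inequality suffices; otherwise both vectors are normalised.
  The two entries of the minimum belong to these cases.\<close>

lemma uniformly_convex_norm_add_le:
  fixes x y :: "'a::real_normed_vector"
  assumes c: "0 < c" "\<forall>t. 0 < t \<and> t \<le> 2 \<longrightarrow> ereal (c * t powr p) \<le> modulus_of_convexity TYPE('a) t"
    and xy: "norm x \<le> 1" "norm y \<le> 1" and p: "1 \<le> p"
  shows "norm (x + y) \<le> 2 * (1 - min (c / 2 / 2 powr p) (1 / 4 / 2 powr p) * norm (x - y) powr p)"
proof -
  define t where "t = norm (x - y)"
  let ?c = "min (c / 2 / 2 powr p) (1 / 4 / 2 powr p)"
  have t2: "t \<le> 2" using xy norm_triangle_ineq4[of x y] by (simp add: t_def)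
  show ?thesis
  proof (cases "t = 0")
    case True
    then show ?thesis using xy norm_triangle_ineq[of x y] by (simp add: t_def)
  next
    case False
    then have t: "t > 0" by (simp add: t_def)
    have main: "norm (x + y) \<le> 2 * (1 - ?c * norm (x - y) powr p)"
      if ab: "norm x \<le> norm y" and xy: "norm x \<le> 1" "norm y \<le> 1" and txy: "norm (x - y) = t" for x y :: 'a
    proof (cases "norm x \<le> 1 - t / 4")
      case True
      have "?c * t powr p \<le> 1 / 4 / 2 powr p * t powr p" by (intro mult_right_mono) auto
      also have "\<dots> = 1 / 4 * (t / 2) powr p" using t by (simp add: powr_divide)
      also have "(t / 2) powr p \<le> (t / 2) powr 1" by (rule powr_mono') (use t t2 p in auto)
      finally have "2 * (?c * t powr p) \<le> t / 4" using t by simp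
      then have "norm (x + y) \<le> 2 - 2 * (?c * t powr p)"
        using norm_triangle_ineq[of x y] True xy by linarith
      then show ?thesis by (simp add: txy algebra_simps)
    next
      case f: False
      define a b where "a = norm x" and "b = norm y"
      have a: "a \<ge> 1/2" using f t2 by (simp add: a_def)
      have b: "b \<ge> a" "b \<le> 1" using ab xy by (auto simp: a_def b_def)
      define x' y' where "x' = x /\<^sub>R a" and "y' = y /\<^sub>R b"
      have x: "x = a *\<^sub>R x'" and y: "y = b *\<^sub>R y'" using a b by (auto simp: x'_def y'_def)
      have n: "norm x' = 1" "norm y' = 1" using a b by (auto simp: x'_def y'_def a_def b_def divide_simps)
      \<comment> \<open>Normalising moves each vector by at most \<open>t / 4\<close>, so a distance
        of at least \<open>t / 2\<close> remains.\<close>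
      have "x - y = (a - 1) *\<^sub>R x' + (x' - y') + (1 - b) *\<^sub>R y'" by (simp add: x y algebra_simps)
      then have "t \<le> norm ((a - 1) *\<^sub>R x') + norm (x' - y') + norm ((1 - b) *\<^sub>R y')"
        using norm_triangle_ineq[of "(a - 1) *\<^sub>R x' + (x' - y')" "(1 - b) *\<^sub>R y'"]
          norm_triangle_ineq[of "(a - 1) *\<^sub>R x'" "x' - y'"] txy by simp
      then have "t / 2 \<le> norm (x' - y')" using n a b f by (simp add: a_def)
      then have "modulus_of_convexity TYPE('a) (t / 2) \<le> ereal (1 - norm ((x' + y') /\<^sub>R 2))"
        unfolding modulus_of_convexity_def by (intro Inf_lower) (use n in blast)
      moreover have "ereal (c * (t / 2) powr p) \<le> modulus_of_convexity TYPE('a) (t / 2)"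
        using c(2) t t2 by simp
      ultimately have "ereal (c * (t / 2) powr p) \<le> ereal (1 - norm ((x' + y') /\<^sub>R 2))" by (rule order_trans[rotated])
      then have "norm (x' + y') \<le> 2 * (1 - c * (t / 2) powr p)" by simp
      also have "\<dots> \<le> 2 * (1 - 2 * (?c * t powr p))"
      proof -
        have "?c * t powr p \<le> c / 2 / 2 powr p * t powr p" by (intro mult_right_mono) auto
        also have "\<dots> = c / 2 * (t / 2) powr p" using t by (simp add: powr_divide)
        finally have "2 * (?c * t powr p) \<le> c * (t / 2) powr p" by (simp only: mult_2)
        then show ?thesis by (intro mult_left_mono diff_left_mono) auto
      qed
      finally have mid: "norm (x' + y') \<le> 2 * (1 - 2 * (?c * t powr p))" .
      have e0: "?c * t powr p \<ge> 0" using c by simp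
      \<comment> \<open>Only the multiple \<open>a\<close> of \<open>x' + y'\<close> profits from
        convexity; \<open>a \<ge> 1/2\<close> costs the factor 2 that was kept in reserve in
        \<open>mid\<close>.\<close>
      have "x + y = a *\<^sub>R (x' + y') + (b - a) *\<^sub>R y'" by (simp add: x y algebra_simps)
      then have "norm (x + y) \<le> a * norm (x' + y') + (b - a)"
        using norm_triangle_ineq[of "a *\<^sub>R (x' + y')" "(b - a) *\<^sub>R y'"] a b n by simp
      also have "\<dots> \<le> a * (2 * (1 - 2 * (?c * t powr p))) + (b - a)"
        using mid a by simp
      also have "\<dots> = a + b - 4 * a * (?c * t powr p)" by (simp add: algebra_simps)
      also have "\<dots> \<le> 2 - 2 * (?c * t powr p)"
        using mult_right_mono[OF a e0] b by simp
      finally show ?thesis by (simp add: txy algebra_simps)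
    qed
    show ?thesis
    proof (cases "norm x \<le> norm y")
      case True
      then show ?thesis using main xy t_def by simp
    next
      case False
      then show ?thesis using main[of y x] xy by (simp add: t_def norm_minus_commute add.commute)
    qed
  qed
qed

section \<open>Finitely supported sequences in \<open>\<ell>\<^sub>q\<close>\<close>

lemma lq_dist_finite_support:
  assumes "\<And>i. i > k \<Longrightarrow> x i = 0" "\<And>i. i > k \<Longrightarrow> y i = 0"
  shows "lq_dist q x y = (\<Sum>i\<le>k. \<bar>x i - y i\<bar> powr q) powr (1 / q)"
  unfolding lq_dist_def lq_norm_def by (subst suminf_finite[of "{..k}"]) (use assms in auto)

lemma finite_support_in_lq:
  assumes "\<And>i. i > k \<Longrightarrow> x i = 0"
  shows "x \<in> lq q"
  unfolding lq_def mem_Collect_eq by (rule summable_finite[of "{..k}"]) (simp_all add: assms)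

lemma lq_dist_ge_coordinate:
  assumes "\<And>i. i > k \<Longrightarrow> x i = 0" "\<And>i. i > k \<Longrightarrow> y i = 0" "q > 0"
  shows "\<bar>x i - y i\<bar> \<le> lq_dist q x y"
proof (cases "i \<le> k")
  case True
  have "\<bar>x i - y i\<bar> = (\<bar>x i - y i\<bar> powr q) powr (1 / q)" using assms by (simp add: powr_powr)
  also have "\<dots> \<le> (\<Sum>i\<le>k. \<bar>x i - y i\<bar> powr q) powr (1 / q)"
    by (intro powr_mono2 member_le_sum) (use True assms in auto)
  finally show ?thesis using lq_dist_finite_support[of k x y q] assms by simp
next
  case False
  then show ?thesis using assms by (simp add: lq_dist_def lq_norm_def)
qed

lemma Metric_space_lq_dist_finite_support:
  assumes "1 \<le> q" and M: "\<And>x i. x \<in> M \<Longrightarrow> i > k \<Longrightarrow> x i = 0"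
  shows "Metric_space M (lq_dist q)"
proof
  show "0 \<le> lq_dist q x y" for x y by (simp add: lq_dist_def lq_norm_def)
  show "lq_dist q x y = lq_dist q y x" for x y by (simp add: lq_dist_def lq_norm_def abs_minus_commute)
  show "lq_dist q x y = 0 \<longleftrightarrow> x = y" if "x \<in> M" "y \<in> M" for x y
  proof
    assume "lq_dist q x y = 0"
    then have "\<bar>x i - y i\<bar> \<le> 0" for i
      using lq_dist_ge_coordinate[of k x y q i] M that assms by auto
    then show "x = y" by (auto intro!: ext)
  qed (simp add: lq_dist_def lq_norm_def)
  show "lq_dist q x z \<le> lq_dist q x y + lq_dist q y z" if "x \<in> M" "y \<in> M" "z \<in> M" for x y z
    using Minkowski_sum[of q "\<lambda>i. x i - y i" "\<lambda>i. y i - z i" "{..k}"] that assms(1)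
    by (simp add: lq_dist_finite_support[of k] M)
qed

section \<open>Thin Laakso sets\<close>

text \<open>The distance to the nearest odd integer.\<close>

definition zigzag :: "real \<Rightarrow> real" where
  "zigzag v = \<bar>v - of_int (2 * \<lfloor>v / 2\<rfloor> + 1)\<bar>"

section \<open>Elementary properties of the zigzag function\<close>

lemma zigzag_nonneg [simp]: "0 \<le> zigzag v"
  by (simp add: zigzag_def)

lemma zigzag_le_1: "zigzag v \<le> 1"
  unfolding zigzag_def by (simp add: abs_le_iff) linarith

lemma zigzag_of_odd [simp]: "odd n \<Longrightarrow> zigzag (of_int n) = 0"
proof (elim oddE)
  fix b assume n: "n = 2 * b + 1"
  have "\<lfloor>real_of_int n / 2\<rfloor> = b" unfolding n by (rule floor_unique) auto
  then show ?thesis by (simp add: zigzag_def n)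
qed

lemma zigzag_of_even [simp]: "even n \<Longrightarrow> zigzag (of_int n) = 1"
  by (elim evenE) (simp add: zigzag_def)

text \<open>The integer in the definition is the midpoint of the interval between consecutive even
  integers that contains \<open>v\<close>; every other odd integer is at distance at least
  1.\<close>

lemma zigzag_le_dist_odd:
  assumes "odd n"
  shows "zigzag v \<le> \<bar>v - of_int n\<bar>"
proof (cases "n = 2 * \<lfloor>v / 2\<rfloor> + 1")
  case False
  obtain b where n: "n = 2 * b + 1" using assms by (elim oddE)
  have "b < \<lfloor>v / 2\<rfloor> \<or> b > \<lfloor>v / 2\<rfloor>" using False n by auto
  then have "\<bar>v - of_int n\<bar> \<ge> 1"
  proof
    assume "b < \<lfloor>v / 2\<rfloor>"
    then have "real_of_int (b + 1) \<le> v / 2" by linarith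
    then show ?thesis unfolding n by simp
  next
    assume "b > \<lfloor>v / 2\<rfloor>"
    then have "v / 2 < real_of_int b" by linarith
    then show ?thesis unfolding n by simp
  qed
  then show ?thesis using zigzag_le_1[of v] by linarith
qed (simp add: zigzag_def)

lemma zigzag_eq_dist_odd: "\<exists>n. odd n \<and> zigzag v = \<bar>v - of_int n\<bar>"
  by (rule exI[of _ "2 * \<lfloor>v / 2\<rfloor> + 1"]) (simp add: zigzag_def)

lemma zigzag_Lipschitz: "\<bar>zigzag v - zigzag w\<bar> \<le> \<bar>v - w\<bar>"
proof -
  have "zigzag v \<le> zigzag w + \<bar>v - w\<bar>" for v w
  proof -
    obtain n where n: "odd n" "zigzag w = \<bar>w - of_int n\<bar>" using zigzag_eq_dist_odd by blast
    show ?thesis using zigzag_le_dist_odd[OF n(1), of v] n(2) by linarith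
  qed
  from this[of v w] this[of w v] show ?thesis by linarith
qed

text \<open>The factors \<open>4 ^ i\<close> inside and outside cancel, so all levels share the
  Lipschitz constant \<open>\<delta>\<close>.\<close>

lemma scaled_zigzag_Lipschitz:
  assumes "0 \<le> \<delta>"
  shows "\<bar>\<delta> / 4 ^ i * zigzag (4 ^ i * x) - \<delta> / 4 ^ i * zigzag (4 ^ i * y)\<bar> \<le> \<delta> * \<bar>x - y\<bar>"
proof -
  have "\<bar>\<delta> / 4 ^ i * zigzag (4 ^ i * x) - \<delta> / 4 ^ i * zigzag (4 ^ i * y)\<bar>
      = \<delta> / 4 ^ i * \<bar>zigzag (4 ^ i * x) - zigzag (4 ^ i * y)\<bar>"
    using assms by (simp only: right_diff_distrib[symmetric] abs_mult) simp
  also have "\<dots> \<le> \<delta> / 4 ^ i * \<bar>4 ^ i * x - 4 ^ i * y\<bar>"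
    by (intro mult_left_mono zigzag_Lipschitz) (use assms in auto)
  also have "\<dots> = \<delta> * \<bar>x - y\<bar>"
    by (simp only: right_diff_distrib[symmetric] abs_mult) simp
  finally show ?thesis .
qed

text \<open>The coordinate \<open>w 0\<close> ranges over all reals, which leaves room for padding
  samples to any cardinality.\<close>

definition laakso_set :: "nat \<Rightarrow> real \<Rightarrow> (nat \<Rightarrow> real) set" where
  "laakso_set k \<delta> = {w. (\<forall>i\<in>{1..k}. \<bar>w i\<bar> = \<delta> / 4 ^ i * zigzag (4 ^ i * w 0)) \<and> (\<forall>i>k. w i = 0)}"

text \<open>\<open>A\<close> is the set of levels with negative sign.\<close>

definition laakso_point :: "nat \<Rightarrow> real \<Rightarrow> nat set \<Rightarrow> real \<Rightarrow> nat \<Rightarrow> real" where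
  "laakso_point k \<delta> A x = (\<lambda>i. if i = 0 then x else if i \<le> k then
     (if i \<in> A then - 1 else 1) * (\<delta> / 4 ^ i * zigzag (4 ^ i * x)) else 0)"

text \<open>Where an amplitude vanishes, different sign sets \<open>A\<close> give the same point;
  these identifications close up the diamonds.\<close>

definition laakso_grid :: "nat \<Rightarrow> real \<Rightarrow> (nat \<Rightarrow> real) set" where
  "laakso_grid k \<delta> = (\<lambda>(m, A). laakso_point k \<delta> A (real m / 4 ^ k)) ` ({..4 ^ k} \<times> Pow {1..k})"

lemma laakso_set_support: "w \<in> laakso_set k \<delta> \<Longrightarrow> i > k \<Longrightarrow> w i = 0"
  by (simp add: laakso_set_def)

lemma laakso_point_0 [simp]: "laakso_point k \<delta> A x 0 = x"
  by (simp add: laakso_point_def)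

lemma laakso_point_support: "i > k \<Longrightarrow> laakso_point k \<delta> A x i = 0"
  by (simp add: laakso_point_def)

lemma laakso_point_in_laakso_set: "0 \<le> \<delta> \<Longrightarrow> laakso_point k \<delta> A x \<in> laakso_set k \<delta>"
  by (auto simp: laakso_set_def laakso_point_def abs_mult)

lemma laakso_grid_subset: "0 \<le> \<delta> \<Longrightarrow> laakso_grid k \<delta> \<subseteq> laakso_set k \<delta>"
  by (auto simp: laakso_grid_def laakso_point_in_laakso_set)

lemma finite_laakso_grid: "finite (laakso_grid k \<delta>)"
  by (simp add: laakso_grid_def)

lemma card_laakso_grid: "card (laakso_grid k \<delta>) \<le> 2 * 8 ^ k"
proof -
  have "card (laakso_grid k \<delta>) \<le> card ({..4 ^ k :: nat} \<times> Pow {1..k})"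
    unfolding laakso_grid_def by (rule card_image_le) simp
  also have "\<dots> = (4 ^ k + 1) * 2 ^ k" by (simp add: card_Pow)
  also have "\<dots> \<le> (2 * 4 ^ k) * 2 ^ k" by simp
  also have "\<dots> = 2 * 8 ^ k" by (simp add: power_mult_distrib[symmetric])
  finally show ?thesis .
qed

lemma laakso_point_in_grid:
  assumes "j \<le> k" "m \<le> 4 ^ j" "A \<subseteq> {1..k}"
  shows "laakso_point k \<delta> A (real m / 4 ^ j) \<in> laakso_grid k \<delta>"
proof -
  have k: "(4::'c::semiring_1) ^ k = 4 ^ j * 4 ^ (k - j)" using assms by (simp add: power_add[symmetric])
  have "real m / 4 ^ j = real (m * 4 ^ (k - j)) / 4 ^ k"
    by (simp add: k)
  moreover have "m * 4 ^ (k - j) \<le> 4 ^ k" using assms by (simp add: k)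
  ultimately show ?thesis unfolding laakso_grid_def using assms
    by (intro image_eqI[where x="(m * 4 ^ (k - j), A)"]) auto
qed

lemma infinite_laakso_set:
  assumes "0 \<le> \<delta>"
  shows "infinite (laakso_set k \<delta>)"
proof -
  have "inj (laakso_point k \<delta> {})" by (metis injI laakso_point_0)
  then have "infinite (range (laakso_point k \<delta> {}))"
    by (simp add: finite_image_iff infinite_UNIV_char_0)
  moreover have "range (laakso_point k \<delta> {}) \<subseteq> laakso_set k \<delta>"
    using assms laakso_point_in_laakso_set by auto
  ultimately show ?thesis using finite_subset by blast
qed

text \<open>Each of the \<open>k\<close> levels contributes at most
  \<open>(\<delta> * \<bar>x - y\<bar>) powr q\<close>, and by \<open>k \<delta>^q \<le> 1\<close>
  together they contribute no more than the \<open>x\<close>-axis.\<close>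

lemma lq_dist_same_signs_le:
  assumes q: "1 \<le> q" and \<delta>: "0 \<le> \<delta>" "real k * \<delta> powr q \<le> 1"
  shows "lq_dist q (laakso_point k \<delta> A x) (laakso_point k \<delta> A y) \<le> 2 * \<bar>x - y\<bar>"
proof -
  have "(\<Sum>i\<le>k. \<bar>laakso_point k \<delta> A x i - laakso_point k \<delta> A y i\<bar> powr q)
      = \<bar>x - y\<bar> powr q + (\<Sum>i\<in>{1..k}. \<bar>laakso_point k \<delta> A x i - laakso_point k \<delta> A y i\<bar> powr q)"
    by (simp add: atMost_atLeast0 sum.atLeast_Suc_atMost)
  also have "\<dots> \<le> \<bar>x - y\<bar> powr q + (\<Sum>i\<in>{1..k}. (\<delta> * \<bar>x - y\<bar>) powr q)"
  proof (intro add_left_mono sum_mono powr_mono2)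
    fix i assume i: "i \<in> {1..k}"
    show "\<bar>laakso_point k \<delta> A x i - laakso_point k \<delta> A y i\<bar> \<le> \<delta> * \<bar>x - y\<bar>"
      using scaled_zigzag_Lipschitz[OF \<delta>(1), of i x y] i
      by (auto simp: laakso_point_def abs_minus_commute)
  qed (use q in auto)
  also have "\<dots> = (1 + real k * \<delta> powr q) * \<bar>x - y\<bar> powr q"
    using \<delta> by (simp add: powr_mult algebra_simps)
  also have "\<dots> \<le> 2 powr q * \<bar>x - y\<bar> powr q"
  proof (rule mult_right_mono)
    have "(2::real) powr 1 \<le> 2 powr q" by (rule powr_mono) (use q in auto)
    then show "1 + real k * \<delta> powr q \<le> 2 powr q" using \<delta> by simp
  qed simp
  also have "\<dots> = (2 * \<bar>x - y\<bar>) powr q" by (simp add: powr_mult)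
  finally have "(\<Sum>i\<le>k. \<bar>laakso_point k \<delta> A x i - laakso_point k \<delta> A y i\<bar> powr q) powr (1 / q)
     \<le> ((2 * \<bar>x - y\<bar>) powr q) powr (1 / q)"
    by (intro powr_mono2) (use q in \<open>auto intro: sum_nonneg\<close>)
  then show ?thesis using q by (simp add: lq_dist_finite_support[of k] laakso_point_support powr_powr)
qed

section \<open>Diamonds and distortion\<close>

text \<open>Besides the triangle inequality, the only property of the target space that the lower bound uses: \<open>b\<close> and \<open>b'\<close> are two
  approximate midpoints of \<open>a\<close> and \<open>c\<close>.\<close>

definition diamond_convex :: "'b set \<Rightarrow> ('b \<Rightarrow> 'b \<Rightarrow> real) \<Rightarrow> real \<Rightarrow> real \<Rightarrow> bool" where
  "diamond_convex Y d \<kappa> p \<longleftrightarrow>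
    (\<forall>a\<in>Y. \<forall>b\<in>Y. \<forall>b'\<in>Y. \<forall>c\<in>Y. \<forall>M>0. d a b \<le> M \<and> d b c \<le> M \<and> d a b' \<le> M \<and> d b' c \<le> M \<longrightarrow>
      d a c \<le> 2 * M * (1 - \<kappa> * (d b b' / M) powr p))"

text \<open>Edge lengths, normalised by \<open>r / 4 ^ j\<close>, are at most \<open>2 * D\<close>
  at level \<open>k\<close> and drop by \<open>\<eta>\<close> per level towards level 0, yet the
  \<open>x\<close>-axis keeps them at least 1. Hence \<open>k * \<eta> \<le> 2 * D\<close>.\<close>

lemma laakso_grid_embedding_bound:
  assumes q: "1 \<le> q" and \<delta>: "0 < \<delta>" "real k * \<delta> powr q \<le> 1"
    and tri: "\<And>x y z. x \<in> Y \<Longrightarrow> y \<in> Y \<Longrightarrow> z \<in> Y \<Longrightarrow> dY x z \<le> dY x y + dY y z"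
    and diamond: "diamond_convex Y dY \<kappa> p" and \<kappa>: "0 \<le> \<kappa>" and p: "1 \<le> p"
    and L: "laakso_grid k \<delta> \<subseteq> L" and f: "f ` L \<subseteq> Y" and r: "0 < r"
    and emb: "\<And>x y. x \<in> L \<Longrightarrow> y \<in> L \<Longrightarrow> r * lq_dist q x y \<le> dY (f x) (f y)"
      "\<And>x y. x \<in> L \<Longrightarrow> y \<in> L \<Longrightarrow> dY (f x) (f y) \<le> r * D * lq_dist q x y"
    and D: "1 \<le> D"
  shows "real k * \<kappa> * (\<delta> / D) powr p \<le> 2"
proof -
  define F where "F A x = f (laakso_point k \<delta> A x)" for A x
  \<comment> \<open>\<open>E j e\<close>: the images of level \<open>j\<close> edges have length at most \<open>r * e / 4 ^ j\<close>. Signs beyond level \<open>j\<close> are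
    positive at both ends.\<close>
  define E where "E j e \<longleftrightarrow> (\<forall>m<4 ^ j. \<forall>A\<subseteq>{1..j}.
    dY (F A (real m / 4 ^ j)) (F A (real (m + 1) / 4 ^ j)) \<le> r * e / 4 ^ j)" for j :: nat and e
  \<comment> \<open>A diamond with edge bound \<open>e\<close> yields the drop
    \<open>\<kappa> e (2 \<delta> / e)^p / 2\<close>; this is its value at \<open>e = 2 * D\<close>,
    the least one for \<open>e \<le> 2 * D\<close>.\<close>
  define \<eta> where "\<eta> = \<kappa> * D * (\<delta> / D) powr p"
  have \<eta>0: "\<eta> \<ge> 0" using \<kappa> D by (simp add: \<eta>_def)
  have inL: "laakso_point k \<delta> A (real m / 4 ^ j) \<in> L" if "j \<le> k" "m \<le> 4 ^ j" "A \<subseteq> {1..k}" for j m A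
    using laakso_point_in_grid[OF that] L by blast
  have inY: "F A (real m / 4 ^ j) \<in> Y" if "j \<le> k" "m \<le> 4 ^ j" "A \<subseteq> {1..k}" for j m A
    unfolding F_def using inL[OF that] f by blast
  have lower: "r * \<bar>laakso_point k \<delta> A (real m / 4 ^ j) i - laakso_point k \<delta> B (real n / 4 ^ j) i\<bar>
      \<le> dY (F A (real m / 4 ^ j)) (F B (real n / 4 ^ j))"
    if "j \<le> k" "m \<le> 4 ^ j" "n \<le> 4 ^ j" "A \<subseteq> {1..k}" "B \<subseteq> {1..k}" for j m n A B i
  proof -
    have "r * \<bar>laakso_point k \<delta> A (real m / 4 ^ j) i - laakso_point k \<delta> B (real n / 4 ^ j) i\<bar>
      \<le> r * lq_dist q (laakso_point k \<delta> A (real m / 4 ^ j)) (laakso_point k \<delta> B (real n / 4 ^ j))"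
      using r q by (intro mult_left_mono lq_dist_ge_coordinate[of k]) (auto simp: laakso_point_support)
    also have "\<dots> \<le> dY (F A (real m / 4 ^ j)) (F B (real n / 4 ^ j))"
      unfolding F_def by (intro emb(1) inL) (use that in auto)
    finally show ?thesis .
  qed
  have E_ge_1: "1 \<le> e" if "E j e" "j \<le> k" for j e
  proof -
    have "r * (1 / 4 ^ j) = r * \<bar>laakso_point k \<delta> {} (real 0 / 4 ^ j) 0 - laakso_point k \<delta> {} (real 1 / 4 ^ j) 0\<bar>"
      by simp
    also have "\<dots> \<le> dY (F {} (real 0 / 4 ^ j)) (F {} (real 1 / 4 ^ j))"
      by (rule lower) (use that in auto)
    also have "\<dots> \<le> r * e / 4 ^ j"
      using that(1)[unfolded E_def, rule_format, of 0 "{}"] by simp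
    finally show ?thesis using r by (simp add: divide_le_cancel)
  qed
  have top: "E k (2 * D)"
    unfolding E_def
  proof (intro allI impI)
    fix m :: nat and A assume m: "m < 4 ^ k" and A: "A \<subseteq> {1..k}"
    have "dY (F A (real m / 4 ^ k)) (F A (real (m + 1) / 4 ^ k)) \<le>
       r * D * lq_dist q (laakso_point k \<delta> A (real m / 4 ^ k)) (laakso_point k \<delta> A (real (m + 1) / 4 ^ k))"
      unfolding F_def by (intro emb(2) inL) (use m A in auto)
    also have "\<dots> \<le> r * D * (2 * \<bar>real m / 4 ^ k - real (m + 1) / 4 ^ k\<bar>)"
      by (intro mult_left_mono lq_dist_same_signs_le) (use q \<delta> r D in auto)
    also have "\<bar>real m / 4 ^ k - real (m + 1) / 4 ^ k\<bar> = 1 / 4 ^ k"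
      by (simp add: diff_divide_distrib[symmetric])
    finally show "dY (F A (real m / 4 ^ k)) (F A (real (m + 1) / 4 ^ k)) \<le> r * (2 * D) / 4 ^ k"
      by (simp add: mult_ac)
  qed
  have step: "E j (e - \<eta>)" if E: "E (Suc j) e" and j: "j < k" and e: "e \<le> 2 * D" for j e
    unfolding E_def
  proof (intro allI impI)
    fix m :: nat and A assume m: "m < 4 ^ j" and A: "A \<subseteq> {1..j}"
    have e1: "1 \<le> e" using E_ge_1[OF E] j by simp
    \<comment> \<open>\<open>P 0\<close> to \<open>P 4\<close> are the \<open>x\<close>-coordinates of \<open>s, a, b, c, t\<close>; the second midpoint \<open>b'\<close> has signs \<open>B\<close>.\<close>
    define B where "B = insert (Suc j) A"
    define P where "P i = real (4 * m + i) / 4 ^ Suc j" for i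
    define M where "M = r * e / 4 ^ Suc j"
    have M: "M > 0" using r e1 by (simp add: M_def)
    have P0: "real m / 4 ^ j = P 0" and P4: "real (m + 1) / 4 ^ j = P 4"
      by (auto simp: P_def field_simps)
    have AB: "A \<subseteq> {1..Suc j}" "B \<subseteq> {1..Suc j}" "A \<subseteq> {1..k}" "B \<subseteq> {1..k}"
      using A j by (auto simp: B_def)
    have mi: "4 * m + i < 4 ^ Suc j" if "i < 4" for i using m that by simp
    have edge: "dY (F C (P i)) (F C (P i')) \<le> M" if "i < 4" "C \<subseteq> {1..Suc j}" "i' = Suc i" for i i' C
      using E mi[OF that(1)] that(2,3) unfolding E_def P_def M_def by force
    have PY: "F C (P i) \<in> Y" if "i \<le> 4" "C \<subseteq> {1..k}" for i C
      unfolding P_def by (rule inY) (use that j m in auto)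
    have z: "zigzag (4 ^ Suc j * P i) = (if even i then 1 else 0)" for i
    proof -
      have "4 ^ Suc j * P i = of_int (int (4 * m + i))" by (simp add: P_def)
      moreover have "even (int (4 * m + i)) \<longleftrightarrow> even i" by simp
      ultimately show ?thesis by (metis zigzag_of_even zigzag_of_odd)
    qed
    \<comment> \<open>At odd multiples of \<open>1 / 4 ^ Suc j\<close> the amplitude of level
      \<open>Suc j\<close> vanishes, so \<open>a\<close> and \<open>c\<close> belong to both
      paths.\<close>
    have same: "F B (P i) = F A (P i)" if "odd i" for i
    proof -
      have "laakso_point k \<delta> B (P i) = laakso_point k \<delta> A (P i)"
      proof
        fix l
        show "laakso_point k \<delta> B (P i) l = laakso_point k \<delta> A (P i) l"
          using z[of i] that by (cases "l = Suc j") (auto simp: laakso_point_def B_def)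
      qed
      then show ?thesis by (simp add: F_def)
    qed
    \<comment> \<open>At \<open>P 2\<close> the zigzag is 1, so the two midpoints have opposite
      coordinates \<open>Suc j\<close> of full amplitude.\<close>
    have "r * (2 * \<delta> / 4 ^ Suc j) = r * \<bar>laakso_point k \<delta> A (P 2) (Suc j) - laakso_point k \<delta> B (P 2) (Suc j)\<bar>"
    proof -
      have "Suc j \<notin> A" using A by auto
      then have "laakso_point k \<delta> A (P 2) (Suc j) = \<delta> / 4 ^ Suc j" "laakso_point k \<delta> B (P 2) (Suc j) = - (\<delta> / 4 ^ Suc j)"
        using z[of 2] j by (auto simp: laakso_point_def B_def)
      then show ?thesis using \<delta> by simp
    qed
    also have "\<dots> \<le> dY (F A (P 2)) (F B (P 2))"
      unfolding P_def by (rule lower) (use AB j m in auto)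
    finally have bb: "2 * \<delta> / e \<le> dY (F A (P 2)) (F B (P 2)) / M"
      using r e1 by (simp add: M_def field_simps)
    have ac: "dY (F A (P 1)) (F A (P 3)) \<le> 2 * M * (1 - \<kappa> * (dY (F A (P 2)) (F B (P 2)) / M) powr p)"
    proof -
      have "dY (F A (P 1)) (F A (P 2)) \<le> M" "dY (F A (P 2)) (F A (P 3)) \<le> M"
        using edge[of 1 A 2] edge[of 2 A 3] AB by simp_all
      moreover have "dY (F A (P 1)) (F B (P 2)) \<le> M" "dY (F B (P 2)) (F A (P 3)) \<le> M"
        using edge[of 1 B 2] edge[of 2 B 3] AB same[of 1] same[of 3] by simp_all
      ultimately show ?thesis
        using diamond M PY AB unfolding diamond_convex_def by simp
    qed
    also have "\<dots> \<le> 2 * M * (1 - \<kappa> * (2 * \<delta> / e) powr p)"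
      by (intro mult_left_mono diff_left_mono powr_mono2) (use M \<kappa> bb p \<delta> e1 in auto)
    also have "\<dots> \<le> 2 * M * (1 - 2 * \<eta> / e)"
    proof (intro mult_left_mono diff_left_mono)
      \<comment> \<open>The exponent \<open>1 - p\<close> is not positive, so
        \<open>e = 2 * D\<close> is the worst case.\<close>
      have "(2 * D) powr (1 - p) \<le> e powr (1 - p)"
        by (rule powr_mono2') (use p e e1 in auto)
      then have "(2 * \<delta>) powr p * (2 * D) powr (1 - p) \<le> (2 * \<delta>) powr p * e powr (1 - p)"
        by (rule mult_left_mono) simp
      moreover have "(2 * \<delta>) powr p * (2 * D) powr (1 - p) = 2 * D * (\<delta> / D) powr p"
        using D \<delta> by (simp add: powr_diff powr_divide powr_mult)
      moreover have "(2 * \<delta>) powr p * e powr (1 - p) = e * (2 * \<delta> / e) powr p"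
        using e1 \<delta> by (simp add: powr_diff powr_divide)
      ultimately have "2 * D * (\<delta> / D) powr p \<le> e * (2 * \<delta> / e) powr p" by simp
      then have "\<kappa> * (2 * D * (\<delta> / D) powr p) \<le> \<kappa> * (e * (2 * \<delta> / e) powr p)"
        by (rule mult_left_mono) (rule \<kappa>)
      then show "2 * \<eta> / e \<le> \<kappa> * (2 * \<delta> / e) powr p"
        using e1 by (simp add: \<eta>_def field_simps)
    qed (use M in auto)
    finally have ac: "dY (F A (P 1)) (F A (P 3)) \<le> 2 * M * (1 - 2 * \<eta> / e)" .
    have "dY (F A (P 0)) (F A (P 4)) \<le> dY (F A (P 0)) (F A (P 1)) + dY (F A (P 1)) (F A (P 3)) + dY (F A (P 3)) (F A (P 4))"
      using tri[of "F A (P 0)" "F A (P 1)" "F A (P 4)"] tri[of "F A (P 1)" "F A (P 3)" "F A (P 4)"] PY AB by fastforce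
    \<comment> \<open>Only the two middle quarters gain. Their gain
      \<open>4 * M * \<eta> / e\<close> is exactly \<open>r * \<eta> / 4 ^ j\<close>.\<close>
    also have "\<dots> \<le> M + 2 * M * (1 - 2 * \<eta> / e) + M"
      by (intro add_mono edge ac) (use AB in auto)
    also have "\<dots> = r * (e - \<eta>) / 4 ^ j"
      using e1 by (simp add: M_def field_simps)
    finally show "dY (F A (real m / 4 ^ j)) (F A (real (m + 1) / 4 ^ j)) \<le> r * (e - \<eta>) / 4 ^ j"
      unfolding P0 P4 .
  qed
  have "i \<le> k \<Longrightarrow> E (k - i) (2 * D - real i * \<eta>)" for i
  proof (induction i)
    case 0
    then show ?case using top by simp
  next
    case (Suc i)
    have "E (Suc (k - Suc i)) (2 * D - real i * \<eta>)"
      using Suc by (simp add: Suc_diff_Suc)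
    from step[OF this] Suc show ?case using \<eta>0 by (simp add: algebra_simps)
  qed
  from this[of k] have "E 0 (2 * D - real k * \<eta>)" by simp
  from E_ge_1[OF this] have "real k * \<eta> \<le> 2 * D" by simp
  then show ?thesis using D by (simp add: \<eta>_def mult_ac)
qed

section \<open>Doubling\<close>

text \<open>Filling the gaps of \<open>T\<close> gives a geometric series of ratio
  \<open>1 / 4\<close> with first term at most 1, so even \<open>4 / 3\<close> bounds it.\<close>

lemma sum_inverse_powers_le:
  fixes b :: real
  assumes T: "finite T" and b: "0 \<le> b" and le: "\<And>i. i \<in> T \<Longrightarrow> b / 4 ^ i \<le> 1"
  shows "(\<Sum>i\<in>T. b / 4 ^ i) \<le> 2"
proof (cases "T = {}")
  case False
  define m n where "m = Min T" and "n = Suc (Max T)"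
  have m: "m \<in> T" using T False by (simp add: m_def)
  then have mn: "m \<le> n" using Max_ge[OF T m] by (simp add: n_def)
  have "(\<Sum>i\<in>T. b / 4 ^ i) \<le> (\<Sum>i\<in>{m..<n}. b / 4 ^ i)"
    by (rule sum_mono2) (use T b in \<open>auto simp: m_def n_def less_Suc_eq_le\<close>)
  also have "\<dots> = 4 / 3 * (b / 4 ^ m - b / 4 ^ n)"
    using mn
  proof (induction n rule: dec_induct)
    case (step n)
    have "b / 4 ^ Suc n = b / 4 ^ n / 4" by simp
    then show ?case using step by simp
  qed simp
  also have "\<dots> \<le> 4 / 3 * (1 - 0)"
    by (intro mult_left_mono diff_mono) (use le[of m] T False b in \<open>auto simp: m_def\<close>)
  finally show ?thesis by simp
qed simp

text \<open>Each point of \<open>S\<close> is encoded by a cell of its \<open>x\<close>-coordinate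
  and its signs on \<open>J\<close>. Points with the same code are at distance at most
  \<open>r / 2\<close>, so the encoding is injective on a separated set.\<close>

lemma laakso_set_packing:
  assumes q: "1 \<le> q" and \<delta>: "0 < \<delta>" "real k * \<delta> powr q \<le> 1" and r: "0 < r"
    and z: "z \<in> laakso_set k \<delta>" and S: "S \<subseteq> laakso_set k \<delta>"
    and ball: "\<And>w. w \<in> S \<Longrightarrow> lq_dist q z w \<le> r"
    and sep: "pairwise (\<lambda>v w. r / 2 < lq_dist q v w) S"
  shows "card S \<le> 17 * 32 * 32"
proof -
  \<comment> \<open>Outside \<open>J\<close>, either the sign of \<open>w i\<close> is that of \<open>z i\<close> for every \<open>w\<close> in the ball, or the amplitude
    is negligible.\<close>
  define J where "J = {i\<in>{1..k}. r / 64 < \<delta> / 4 ^ i \<and> \<bar>z i\<bar> \<le> r}"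
  have finJ: "finite J" by (simp add: J_def)
  have near: "\<exists>n. odd n \<and> \<bar>4 ^ i * z 0 - of_int n\<bar> \<le> 4 ^ i * r / \<delta>" if "i \<in> J" for i
  proof -
    obtain n where n: "odd n" "zigzag (4 ^ i * z 0) = \<bar>4 ^ i * z 0 - of_int n\<bar>"
      using zigzag_eq_dist_odd by blast
    have "\<delta> / 4 ^ i * zigzag (4 ^ i * z 0) \<le> r" using that z by (auto simp: J_def laakso_set_def)
    then have "zigzag (4 ^ i * z 0) \<le> 4 ^ i * r / \<delta>" using \<delta> by (simp add: field_simps)
    then show ?thesis using n by auto
  qed
  \<comment> \<open>After scaling by \<open>4 ^ j\<close>, the odd multiple for level
    \<open>i\<close> becomes an even integer and that for level \<open>j\<close> is odd. They differ
    by at least 1, while both are within \<open>4 ^ j * r / \<delta>\<close> of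
    \<open>4 ^ j * z 0\<close>.\<close>
  have gap: "\<delta> / 4 ^ j \<le> 2 * r" if ij: "i \<in> J" "j \<in> J" "i < j" for i j
  proof -
    obtain m where m: "odd m" "\<bar>4 ^ i * z 0 - of_int m\<bar> \<le> 4 ^ i * r / \<delta>" using near ij by blast
    obtain n where n: "odd n" "\<bar>4 ^ j * z 0 - of_int n\<bar> \<le> 4 ^ j * r / \<delta>" using near ij by blast
    have split: "(4::real) ^ j = 4 ^ (j - i) * 4 ^ i" using ij by (simp add: power_add[symmetric])
    have "\<bar>4 ^ j * z 0 - of_int (4 ^ (j - i) * m)\<bar> = 4 ^ (j - i) * \<bar>4 ^ i * z 0 - of_int m\<bar>"
    proof -
      have "4 ^ j * z 0 - of_int (4 ^ (j - i) * m) = 4 ^ (j - i) * (4 ^ i * z 0 - of_int m)"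
        unfolding split by (simp add: algebra_simps)
      then show ?thesis by (simp add: abs_mult)
    qed
    also have "\<dots> \<le> 4 ^ (j - i) * (4 ^ i * r / \<delta>)" by (rule mult_left_mono[OF m(2)]) simp
    also have "\<dots> = 4 ^ j * r / \<delta>" by (simp add: split)
    finally have 1: "\<bar>4 ^ j * z 0 - of_int (4 ^ (j - i) * m)\<bar> \<le> 4 ^ j * r / \<delta>" .
    have "even (4 ^ (j - i) * m)" using ij by simp
    then have "4 ^ (j - i) * m \<noteq> n" using n by auto
    then have "1 \<le> \<bar>4 ^ (j - i) * m - n\<bar>" by linarith
    then have "1 \<le> \<bar>real_of_int (4 ^ (j - i) * m) - real_of_int n\<bar>" by linarith
    also have "\<dots> \<le> 2 * (4 ^ j * r / \<delta>)" using 1 n(2) by linarith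
    finally show ?thesis using \<delta> by (simp add: field_simps)
  qed
  \<comment> \<open>From the second smallest level on, amplitudes in \<open>J\<close> lie between
    \<open>r / 64\<close> and \<open>2 * r\<close>. As \<open>4 ^ 4 > 128\<close>, these are at most
    four levels.\<close>
  have cardJ: "card J \<le> 5"
  proof (cases "J - {Min J} = {}")
    case True
    then have "J \<subseteq> {Min J}" by blast
    then have "card J \<le> card {Min J}" by (rule card_mono[rotated]) simp
    then show ?thesis by simp
  next
    case False
    define i where "i = Min (J - {Min J})"
    have i: "i \<in> J - {Min J}" unfolding i_def by (rule Min_in) (use finJ False in auto)
    have "Min J \<in> J" by (rule Min_in) (use finJ i in auto)
    moreover have "Min J < i" using i finJ by (simp add: order_less_le)
    ultimately have le: "\<delta> / 4 ^ i \<le> 2 * r" using gap i by blast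
    have "J \<subseteq> insert (Min J) {i..<i + 4}"
    proof
      fix j assume j: "j \<in> J"
      show "j \<in> insert (Min J) {i..<i + 4}"
      proof (rule ccontr)
        assume nj: "j \<notin> insert (Min J) {i..<i + 4}"
        then have "i \<le> j" using j finJ unfolding i_def by (intro Min_le) auto
        then have "i + 4 \<le> j" using nj by auto
        then have "(4::real) ^ (i + 4) \<le> 4 ^ j" by (intro power_increasing) auto
        then have "\<delta> / 4 ^ j \<le> \<delta> / 4 ^ (i + 4)" using \<delta> by (intro divide_left_mono) auto
        also have "\<dots> = (\<delta> / 4 ^ i) / 256" by (simp add: power_add)
        also have "\<dots> \<le> 2 * r / 256" using le by simp
        finally have "\<delta> / 4 ^ j \<le> 2 * r / 256" .
        moreover have "r / 64 < \<delta> / 4 ^ j" using j by (simp add: J_def)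
        ultimately show False using r by linarith
      qed
    qed
    then have "card J \<le> card (insert (Min J) {i..<i + 4})" by (rule card_mono[rotated]) simp
    also have "\<dots> \<le> 5" by (simp add: card_insert_if)
    finally show ?thesis .
  qed
  have coord: "\<bar>z i - w i\<bar> \<le> r" if "w \<in> S" for w i
    using lq_dist_ge_coordinate[of k z w q i] laakso_set_support z S that q ball[OF that] by fastforce
  \<comment> \<open>Cells have width \<open>r / 8\<close>, hence 17 indices from -8 to 8. Recording
    positive and negative coordinates separately also fixes the zero ones.\<close>
  define code where "code w = (\<lfloor>8 * (w 0 - z 0) / r\<rfloor>, {i\<in>J. w i > 0}, {i\<in>J. w i < 0})" for w
  have code_range: "code ` S \<subseteq> {-8..8} \<times> Pow J \<times> Pow J"
  proof -
    have "\<lfloor>8 * (w 0 - z 0) / r\<rfloor> \<in> {-8..8}" if "w \<in> S" for w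
      using coord[OF that, of 0] r by (auto simp: le_floor_iff floor_le_iff abs_le_iff field_simps)
    then show ?thesis by (auto simp: code_def)
  qed
  have "inj_on code S"
  proof (rule inj_onI, rule ccontr)
    fix v w assume vw: "v \<in> S" "w \<in> S" "code v = code w" "v \<noteq> w"
    define u where "u i = \<bar>v i - w i\<bar>" for i
    have vX: "v \<in> laakso_set k \<delta>" and wX: "w \<in> laakso_set k \<delta>" using vw S by auto
    have u0: "u 0 \<le> r / 8"
    proof -
      have "\<lfloor>8 * (v 0 - z 0) / r\<rfloor> = \<lfloor>8 * (w 0 - z 0) / r\<rfloor>" using vw(3) by (simp add: code_def)
      then have "\<bar>8 * (v 0 - z 0) / r - 8 * (w 0 - z 0) / r\<bar> \<le> 1" by linarith
      moreover have "8 * (v 0 - z 0) / r - 8 * (w 0 - z 0) / r = 8 * (v 0 - w 0) / r"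
        by (simp add: diff_divide_distrib[symmetric])
      ultimately have "\<bar>8 * (v 0 - w 0)\<bar> \<le> r" using r by (simp add: abs_divide pos_divide_le_eq)
      from this[unfolded abs_mult] show ?thesis by (simp add: u_def)
    qed
    define T where "T = {i\<in>{1..k}. \<delta> / 4 ^ i \<le> r / 64}"
    have big: "u i \<le> \<delta> * (r / 8)" if i: "i \<in> {1..k}" "i \<notin> T" for i
    proof -
      have same_sign: "\<bar>v i - w i\<bar> = \<bar>\<bar>v i\<bar> - \<bar>w i\<bar>\<bar>"
      proof (cases "i \<in> J")
        case True
        have "{i\<in>J. v i > 0} = {i\<in>J. w i > 0}" "{i\<in>J. v i < 0} = {i\<in>J. w i < 0}"
          using vw(3) by (auto simp: code_def)
        then have "v i > 0 \<longleftrightarrow> w i > 0" "v i < 0 \<longleftrightarrow> w i < 0" using True by blast+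
        then show ?thesis by auto
      next
        \<comment> \<open>Here the amplitude is not small, so \<open>i\<close> fails to be in
          \<open>J\<close> because \<open>\<bar>z i\<bar> > r\<close>, and no point of the ball can
          change the sign of \<open>z i\<close>.\<close>
        case False
        then have "\<bar>z i\<bar> > r" using i by (auto simp: J_def T_def)
        then show ?thesis using coord[OF vw(1), of i] coord[OF vw(2), of i] by linarith
      qed
      also have "\<dots> \<le> \<delta> * \<bar>v 0 - w 0\<bar>"
        using scaled_zigzag_Lipschitz[of \<delta> i "v 0" "w 0"] \<delta> vX wX i by (auto simp: laakso_set_def)
      also have "\<dots> \<le> \<delta> * (r / 8)" using u0 \<delta> by (simp add: u_def)
      finally show ?thesis by (simp add: u_def)
    qed
    have small: "u i powr q \<le> (r / 32) powr q * (64 * \<delta> / r / 4 ^ i)" if i: "i \<in> T" for i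
    proof -
      have bound: "\<bar>x i\<bar> \<le> \<delta> / 4 ^ i" if "x \<in> laakso_set k \<delta>" for x
        using that i mult_left_mono[OF zigzag_le_1[of "4 ^ i * x 0"], of "\<delta> / 4 ^ i"] \<delta>
        by (auto simp: laakso_set_def T_def)
      define s where "s = 64 * \<delta> / r / 4 ^ i"
      have s: "0 \<le> s" "s \<le> 1" using i r \<delta> by (auto simp: T_def s_def field_simps)
      have "u i \<le> 2 * (\<delta> / 4 ^ i)" using bound[OF vX] bound[OF wX] by (simp add: u_def)
      also have "\<dots> = (r / 32) * s" using r by (simp add: s_def)
      finally have "u i powr q \<le> ((r / 32) * s) powr q"
        by (intro powr_mono2) (use q in \<open>auto simp: u_def\<close>)
      also have "\<dots> = (r / 32) powr q * s powr q" by (rule powr_mult)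
      \<comment> \<open>Replacing the exponent \<open>q\<close> by 1, allowed by
        \<open>s \<le> 1\<close>, leaves a geometric sum with a bound free of
        \<open>q\<close>.\<close>
      also have "\<dots> \<le> (r / 32) powr q * s powr 1"
        by (intro mult_left_mono powr_mono') (use s q in auto)
      also have "s powr 1 = s" using s by simp
      finally show ?thesis by (simp only: s_def)
    qed
    \<comment> \<open>The \<open>x\<close>-axis, the large levels and the small levels contribute 1,
      1 and 2 times \<open>(r / 8) powr q\<close>; \<open>4 \<le> 4 powr q\<close> turns the total
      into \<open>(r / 2) powr q\<close>.\<close>
    have q4: "4 \<le> (4::real) powr q" using powr_mono[of 1 q "4::real"] q by simp
    have "(\<Sum>i\<le>k. u i powr q) = u 0 powr q + (\<Sum>i\<in>{1..k}. u i powr q)"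
      by (simp add: atMost_atLeast0 sum.atLeast_Suc_atMost)
    also have "(\<Sum>i\<in>{1..k}. u i powr q) = (\<Sum>i\<in>{1..k} - T. u i powr q) + (\<Sum>i\<in>T. u i powr q)"
      by (rule sum.subset_diff) (auto simp: T_def)
    also have "u 0 powr q + ((\<Sum>i\<in>{1..k} - T. u i powr q) + (\<Sum>i\<in>T. u i powr q))
      \<le> (r / 8) powr q + ((r / 8) powr q + 2 * (r / 8) powr q)"
    proof (intro add_mono)
      show "u 0 powr q \<le> (r / 8) powr q" by (intro powr_mono2) (use u0 q in \<open>auto simp: u_def\<close>)
      have "(\<Sum>i\<in>{1..k} - T. u i powr q) \<le> (\<Sum>i\<in>{1..k} - T. (\<delta> * (r / 8)) powr q)"
        by (intro sum_mono powr_mono2) (use big q in \<open>auto simp: u_def\<close>)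
      also have "\<dots> \<le> (\<Sum>i\<in>{1..k}. (\<delta> * (r / 8)) powr q)" by (rule sum_mono2) auto
      also have "\<dots> = (real k * \<delta> powr q) * (r / 8) powr q" by (simp only: powr_mult) simp
      also have "\<dots> \<le> 1 * (r / 8) powr q" by (rule mult_right_mono) (use \<delta> in auto)
      finally show "(\<Sum>i\<in>{1..k} - T. u i powr q) \<le> (r / 8) powr q" by simp
      have "(\<Sum>i\<in>T. u i powr q) \<le> (\<Sum>i\<in>T. (r / 32) powr q * (64 * \<delta> / r / 4 ^ i))"
        by (rule sum_mono) (rule small)
      also have "\<dots> = (r / 32) powr q * (\<Sum>i\<in>T. 64 * \<delta> / r / 4 ^ i)" by (simp add: sum_distrib_left)
      also have "\<dots> \<le> (r / 32) powr q * 2"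
        by (intro mult_left_mono sum_inverse_powers_le)
           (use \<delta> r in \<open>auto simp: T_def field_simps\<close>)
      also have "(r / 32) powr q \<le> (r / 8) powr q" by (rule powr_mono2) (use q r in auto)
      finally show "(\<Sum>i\<in>T. u i powr q) \<le> 2 * (r / 8) powr q" by simp
    qed
    also have "\<dots> = 4 * (r / 8) powr q" by simp
    also have "\<dots> \<le> 4 powr q * (r / 8) powr q" by (rule mult_right_mono[OF q4]) simp
    also have "\<dots> = (r / 2) powr q" using r by (simp add: powr_mult[symmetric])
    finally have "(\<Sum>i\<le>k. u i powr q) powr (1 / q) \<le> ((r / 2) powr q) powr (1 / q)"
      by (intro powr_mono2) (use q in \<open>auto intro: sum_nonneg\<close>)
    then have "lq_dist q v w \<le> r / 2"
      using q r vX wX by (simp add: lq_dist_finite_support[of k] laakso_set_support u_def powr_powr)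
    then show False using pairwiseD[OF sep vw(1,2,4)] by simp
  qed
  then have "card S \<le> card ({-8..8::int} \<times> Pow J \<times> Pow J)"
    by (rule card_inj_on_le[OF _ code_range]) (use finJ in auto)
  also have "\<dots> = 17 * 2 ^ card J * 2 ^ card J" by (simp add: card_Pow finJ)
  also have "\<dots> \<le> 17 * 2 ^ 5 * 2 ^ 5" by (intro mult_le_mono power_increasing cardJ) auto
  finally show ?thesis by simp
qed

text \<open>A maximal \<open>r / 2\<close>-separated subset of the ball is the set of centres: a
  point left uncovered could be added to it.\<close>

lemma doubling_of_packing:
  assumes M: "Metric_space M d" "finite M"
    and packing: "\<And>x r S. \<lbrakk>x \<in> M; 0 < r; S \<subseteq> M; \<And>w. w \<in> S \<Longrightarrow> d x w \<le> r;
      pairwise (\<lambda>v w. r / 2 < d v w) S\<rbrakk> \<Longrightarrow> card S \<le> N"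
  shows "doubling N M d"
  unfolding doubling_def
proof (intro ballI allI impI)
  interpret Metric_space M d by (rule M)
  fix x r assume x: "x \<in> M" and r: "(0::real) < r"
  define \<C> where "\<C> = {C. C \<subseteq> mcball x r \<and> pairwise (\<lambda>v w. r / 2 < d v w) C}"
  have finB: "finite (mcball x r)" using M(2) mcball_subset_mspace by (rule finite_subset[rotated])
  then have "finite \<C>" by (simp add: \<C>_def)
  moreover have "{} \<in> \<C>" by (simp add: \<C>_def)
  ultimately obtain C where C: "C \<in> \<C>" and max: "\<And>B. B \<in> \<C> \<Longrightarrow> C \<subseteq> B \<Longrightarrow> C = B"
    using finite_has_maximal[of \<C>] by (metis empty_iff)
  have CB: "C \<subseteq> mcball x r" and Cs: "pairwise (\<lambda>v w. r / 2 < d v w) C" using C by (auto simp: \<C>_def)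
  have CM: "C \<subseteq> M" using CB mcball_subset_mspace by blast
  have "card C \<le> N" by (rule packing[OF x r CM _ Cs]) (use CB in auto)
  moreover have "mcball x r \<subseteq> (\<Union>c\<in>C. mcball c (r / 2))"
  proof
    fix y assume y: "y \<in> mcball x r"
    show "y \<in> (\<Union>c\<in>C. mcball c (r / 2))"
    proof (cases "y \<in> C")
      case True
      then show ?thesis using CM r by fastforce
    next
      case False
      have "insert y C \<notin> \<C>" using max[of "insert y C"] False by blast
      then have "\<not> pairwise (\<lambda>v w. r / 2 < d v w) (insert y C)" using y CB by (simp add: \<C>_def)
      then obtain c where "c \<in> C" "d y c \<le> r / 2"
        using Cs commute by (auto simp: pairwise_insert not_less)
      then show ?thesis using y CM commute by fastforce
    qed
  qed
  ultimately show "\<exists>C\<subseteq>M. finite C \<and> card C \<le> N \<and> mcball x r \<subseteq> (\<Union>c\<in>C. mcball c (r / 2))"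
    using CM M(2) finite_subset by blast
qed

text \<open>Packing bounds pass to subsets, so the centres can be found inside \<open>L\<close>
  itself. The bound 17408 is far below \<open>2 ^ 32\<close>.\<close>

lemma doubling_subset_laakso_set:
  assumes q: "1 \<le> q" and \<delta>: "0 < \<delta>" "real k * \<delta> powr q \<le> 1"
    and L: "L \<subseteq> laakso_set k \<delta>" "finite L"
  shows "doubling (2 ^ 32) L (lq_dist q)"
proof (rule doubling_of_packing)
  show "Metric_space L (lq_dist q)"
    by (rule Metric_space_lq_dist_finite_support[where k=k]) (use q L laakso_set_support in auto)
  fix x r S assume *: "x \<in> L" "0 < r" "S \<subseteq> L" "\<And>w. w \<in> S \<Longrightarrow> lq_dist q x w \<le> r"
    "pairwise (\<lambda>v w. r / 2 < lq_dist q v w) S"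
  have "card S \<le> 17 * 32 * 32"
    by (rule laakso_set_packing[OF q \<delta> *(2), of x]) (use * L in auto)
  then show "card S \<le> 2 ^ 32" by simp
qed (rule L)

section \<open>Diamonds in normed spaces\<close>

text \<open>Uniform convexity is used twice: for the steps from \<open>a\<close> to the two
  midpoints and for those from the midpoints to \<open>e\<close>. All four steps add up to
  \<open>2 *\<^sub>R (e - a)\<close>.\<close>

lemma diamond_convex_uniformly_convex:
  assumes "uniformly_convex p TYPE('a::real_normed_vector)" "1 \<le> p"
  obtains \<kappa> where "0 < \<kappa>" "diamond_convex (UNIV :: 'a set) dist \<kappa> p"
proof -
  obtain c where c: "c > 0" "\<forall>t. 0 < t \<and> t \<le> 2 \<longrightarrow> ereal (c * t powr p) \<le> modulus_of_convexity TYPE('a) t"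
    using assms unfolding uniformly_convex_def by blast
  define \<kappa> where "\<kappa> = min (c / 2 / 2 powr p) (1 / 4 / 2 powr p)"
  have "dist a e \<le> 2 * M * (1 - \<kappa> * (dist b b' / M) powr p)"
    if M: "M > 0" "dist a b \<le> M" "dist b e \<le> M" "dist a b' \<le> M" "dist b' e \<le> M" for a b b' e :: 'a and M
  proof -
    define x y where "x = (b - a) /\<^sub>R M" and "y = (b' - a) /\<^sub>R M"
    define v w where "v = (e - b) /\<^sub>R M" and "w = (e - b') /\<^sub>R M"
    have scale: "norm ((u - u') /\<^sub>R M) = dist u u' / M" for u u' :: 'a
      using M by (simp add: dist_norm divide_inverse mult.commute)
    have "x - y = (b - b') /\<^sub>R M" "v - w = (b' - b) /\<^sub>R M"
      by (simp_all add: x_def y_def v_def w_def scaleR_diff_right)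
    then have xy: "norm (x - y) = dist b b' / M" "norm (v - w) = dist b b' / M"
      by (simp_all only: scale dist_commute)
    have n: "norm x \<le> 1" "norm y \<le> 1" "norm v \<le> 1" "norm w \<le> 1"
      unfolding x_def y_def v_def w_def scale using M by (simp_all add: dist_commute)
    have "M *\<^sub>R ((x + y) + (v + w)) = 2 *\<^sub>R (e - a)"
      using M by (simp add: x_def y_def v_def w_def scaleR_add_right scaleR_diff_right scaleR_2)
    then have "2 * dist a e = norm (M *\<^sub>R ((x + y) + (v + w)))"
      by (simp add: dist_norm norm_minus_commute)
    also have "\<dots> = M * norm ((x + y) + (v + w))" using M by simp
    also have "\<dots> \<le> M * (norm (x + y) + norm (v + w))"
      by (intro mult_left_mono norm_triangle_ineq) (use M in auto)
    also have "\<dots> \<le> M * (2 * (1 - \<kappa> * (dist b b' / M) powr p) + 2 * (1 - \<kappa> * (dist b b' / M) powr p))"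
      using uniformly_convex_norm_add_le[OF c n(1,2) assms(2)] uniformly_convex_norm_add_le[OF c n(3,4) assms(2)]
      unfolding xy \<kappa>_def[symmetric] by (intro mult_left_mono add_mono) (use M in auto)
    finally show ?thesis by (simp add: algebra_simps)
  qed
  moreover have "\<kappa> > 0" using c by (simp add: \<kappa>_def)
  ultimately show ?thesis using that unfolding diamond_convex_def by blast
qed

text \<open>The sum of the squared diagonals is at most that of the squared sides; coordinatewise
  this is \<open>(a - b + c - b')^2 \<ge> 0\<close>. The constants do not depend on
  \<open>I\<close>.\<close>

lemma diamond_convex_L2_set:
  fixes Y :: "('b \<Rightarrow> real) set"
  assumes "finite I"
  shows "diamond_convex Y (\<lambda>x y. L2_set (\<lambda>i. x i - y i) I) (1 / 8) 2"
  unfolding diamond_convex_def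
proof (intro ballI allI impI, elim conjE)
  fix a b b' c :: "'b \<Rightarrow> real" and M :: real
  let ?d = "\<lambda>x y. L2_set (\<lambda>i. x i - y i) I"
  assume M: "M > 0" "?d a b \<le> M" "?d b c \<le> M" "?d a b' \<le> M" "?d b' c \<le> M"
  have sq: "(?d x y)\<^sup>2 = (\<Sum>i\<in>I. (x i - y i)\<^sup>2)" for x y
    by (simp add: L2_set_def sum_nonneg)
  have "(a i - c i)\<^sup>2 + (b i - b' i)\<^sup>2
     \<le> (a i - b i)\<^sup>2 + (b i - c i)\<^sup>2 + ((a i - b' i)\<^sup>2 + (b' i - c i)\<^sup>2)" for i
    using zero_le_power2[of "a i - b i + c i - b' i"] by (simp add: power2_eq_square algebra_simps)
  then have "(?d a c)\<^sup>2 + (?d b b')\<^sup>2 \<le> (?d a b)\<^sup>2 + (?d b c)\<^sup>2 + ((?d a b')\<^sup>2 + (?d b' c)\<^sup>2)"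
    unfolding sq sum.distrib[symmetric] by (intro sum_mono)
  also have "\<dots> \<le> M\<^sup>2 + M\<^sup>2 + (M\<^sup>2 + M\<^sup>2)"
    by (intro add_mono power_mono) (use M in auto)
  finally have 1: "(?d a c)\<^sup>2 \<le> 4 * M\<^sup>2 - (?d b b')\<^sup>2" by simp
  \<comment> \<open>With this scaling the bound reads \<open>4 M^2 (1 - 2 h)\<close>, which is at
    most \<open>(2 M (1 - h))^2\<close>; here \<open>1 / 8\<close> arises.\<close>
  define h where "h = (?d b b')\<^sup>2 / (8 * M\<^sup>2)"
  have bb: "(?d b b')\<^sup>2 = 8 * M\<^sup>2 * h" using M by (simp add: h_def)
  have "(?d b b')\<^sup>2 \<le> 4 * M\<^sup>2" using 1 zero_le_power2[of "?d a c"] by linarith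
  then have h2: "h \<le> 1 / 2" using M by (simp add: h_def)
  have "(?d a c)\<^sup>2 \<le> 4 * M\<^sup>2 * (1 - 2 * h)" using 1 unfolding bb by (simp add: algebra_simps)
  also have "\<dots> \<le> 4 * M\<^sup>2 * (1 - h)\<^sup>2"
    by (intro mult_left_mono) (auto simp: power2_eq_square algebra_simps)
  also have "\<dots> = (2 * M * (1 - h))\<^sup>2" by (simp add: power_mult_distrib)
  finally have "?d a c \<le> 2 * M * (1 - h)" by (rule power2_le_imp_le) (use M h2 in auto)
  moreover have "h = 1 / 8 * (?d b b' / M) powr 2"
    using M by (simp add: h_def power_divide)
  ultimately show "?d a c \<le> 2 * M * (1 - 1 / 8 * (?d b b' / M) powr 2)" by simp
qed

section \<open>Samples of \<open>n\<close> points\<close>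

text \<open>Choose \<open>k\<close> with \<open>8 ^ k \<le> n div 2 < 8 ^ (k + 1)\<close>, so that
  the grid has at most \<open>n\<close> points, and pad it. Then \<open>n < 2 ^ (3 * k + 4)\<close>,
  and \<open>3 * k + 4 \<le> 7 * k\<close> for \<open>k \<ge> 1\<close>. For \<open>n < 16\<close>
  any \<open>n\<close> points of the set for \<open>k = 1\<close> serve.\<close>

lemma laakso_sample:
  assumes q: "0 < q" and n: "1 \<le> n"
  obtains k L where "1 \<le> k" "ln (real n) \<le> 7 * real k" "L \<subseteq> laakso_set k (real k powr (- 1 / q))"
    "finite L" "card L = n" "k = 1 \<or> laakso_grid k (real k powr (- 1 / q)) \<subseteq> L"
proof (cases "n < 16")
  case True
  obtain L where L: "finite L" "card L = n" "L \<subseteq> laakso_set 1 (real 1 powr (- 1 / q))"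
    using infinite_arbitrarily_large[OF infinite_laakso_set[of "real 1 powr (- 1 / q)" 1], of n] by auto
  have "ln (real n) \<le> ln (2 ^ 4)" using True n by (subst ln_le_cancel_iff) auto
  also have "\<dots> = 4 * ln 2" by (subst ln_realpow) auto
  finally have "ln (real n) \<le> 7 * real 1" using ln_2_less_1 by simp
  then show ?thesis using that[of 1 L] L by simp
next
  case False
  have half: "1 \<le> n div 2" using False by linarith
  obtain k where k: "8 ^ k \<le> n div 2" "n div 2 < 8 ^ (k + 1)"
    using ex_power_ivl1[of 8 "n div 2"] half by auto
  have k1: "1 \<le> k" using k False by (cases k) auto
  define \<delta> where "\<delta> = real k powr (- 1 / q)"
  have "n < 2 * 8 ^ (k + 1)" using k by auto
  then have "real n \<le> real (2 * 8 ^ (k + 1))" by (simp only: of_nat_le_iff)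
  also have "\<dots> = 2 ^ (3 * k + 4)" by (simp add: power_add power_mult)
  finally have "ln (real n) \<le> ln (2 ^ (3 * k + 4))" using n by (subst ln_le_cancel_iff) auto
  also have "\<dots> = real (3 * k + 4) * ln 2" by (subst ln_realpow) auto
  also have "\<dots> \<le> real (3 * k + 4) * 1" by (rule mult_left_mono) (use ln_2_less_1 in auto)
  also have "\<dots> \<le> 7 * real k" using k1 by simp
  finally have ln: "ln (real n) \<le> 7 * real k" .
  have "infinite (laakso_set k \<delta> - laakso_grid k \<delta>)"
    using infinite_laakso_set[of \<delta> k] finite_laakso_grid[of k \<delta>] by (simp add: \<delta>_def)
  then obtain B where B: "finite B" "card B = n - card (laakso_grid k \<delta>)" "B \<subseteq> laakso_set k \<delta> - laakso_grid k \<delta>"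
    using infinite_arbitrarily_large by blast
  define L where "L = laakso_grid k \<delta> \<union> B"
  have "card L = n"
    unfolding L_def using B finite_laakso_grid[of k \<delta>] card_laakso_grid[of k \<delta>] k
    by (subst card_Un_disjoint) auto
  moreover have "L \<subseteq> laakso_set k \<delta>" using B laakso_grid_subset[of \<delta> k] by (auto simp: L_def \<delta>_def)
  ultimately show ?thesis
    using that[of k L] k1 ln B finite_laakso_grid[of k \<delta>] by (auto simp: L_def \<delta>_def)
qed

text \<open>The target \<open>Y\<close> and its distance are quantified inside, so that one sample
  and one \<open>\<beta>\<close> serve every dimension \<open>d\<close> at once.\<close>

definition distorts :: "'b itself \<Rightarrow> real \<Rightarrow> real \<Rightarrow> real \<Rightarrow> (nat \<Rightarrow> real) set \<Rightarrow> real \<Rightarrow> bool" where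
  "distorts B q \<kappa> p L \<beta> \<longleftrightarrow>
    (\<forall>(Y :: 'b set) d D f. (\<forall>x\<in>Y. \<forall>y\<in>Y. \<forall>z\<in>Y. d x z \<le> d x y + d y z) \<and>
      diamond_convex Y d \<kappa> p \<and> 1 \<le> D \<and> bi_Lipschitz_embedding L (lq_dist q) Y d D f \<longrightarrow> \<beta> \<le> D)"

lemma distortsD:
  fixes Y :: "'b set"
  assumes "distorts TYPE('b) q \<kappa> p L \<beta>"
    and "\<And>x y z. x \<in> Y \<Longrightarrow> y \<in> Y \<Longrightarrow> z \<in> Y \<Longrightarrow> d x z \<le> d x y + d y z"
    and "diamond_convex Y d \<kappa> p" "1 \<le> D" "bi_Lipschitz_embedding L (lq_dist q) Y d D f"
  shows "\<beta> \<le> D"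
  using assms unfolding distorts_def by blast

lemma laakso_sample_distortion:
  fixes p q \<kappa> :: real
  assumes p: "1 \<le> p" "p < q" and \<kappa>: "0 < \<kappa>"
  obtains \<alpha> where "0 < \<alpha>"
    "\<And>n. 1 \<le> n \<Longrightarrow> \<exists>L. L \<subseteq> lq q \<and> finite L \<and> card L = n \<and> doubling (2 ^ 32) L (lq_dist q) \<and>
      distorts TYPE('b) q \<kappa> p L (\<alpha> * ln (real n) powr (1 / p - 1 / q))"
proof -
  define \<theta> where "\<theta> = 1 / p - 1 / q"
  have \<theta>: "\<theta> \<ge> 0" using p by (simp add: \<theta>_def frac_le)
  have q: "1 \<le> q" using p by simp
  \<comment> \<open>The second entry comes from solving
    \<open>k \<kappa> (\<delta> / D)^p \<le> 2\<close> for \<open>D\<close>, the entry 1 covers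
    \<open>k = 1\<close>. The factor \<open>7 powr (- \<theta>)\<close> in \<open>\<alpha>\<close>
    converts \<open>k\<close> into \<open>ln n\<close>.\<close>
  define \<beta> where "\<beta> = min 1 ((\<kappa> / 2) powr (1 / p))"
  define \<alpha> where "\<alpha> = \<beta> * 7 powr (- \<theta>)"
  have \<beta>: "\<beta> > 0" using \<kappa> by (simp add: \<beta>_def)
  show ?thesis
  proof (rule that)
    show "\<alpha> > 0" using \<beta> by (simp add: \<alpha>_def)
    fix n :: nat assume n: "1 \<le> n"
    \<comment> \<open>For \<open>k = 1\<close> the sample need not contain the grid, but then \<open>1 \<le> D\<close> suffices.\<close>
    obtain k L where k: "1 \<le> k" "ln (real n) \<le> 7 * real k" and L: "L \<subseteq> laakso_set k (real k powr (- 1 / q))"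
      "finite L" "card L = n" and grid: "k = 1 \<or> laakso_grid k (real k powr (- 1 / q)) \<subseteq> L"
      using laakso_sample[of q n] q n by auto
    define \<delta> where "\<delta> = real k powr (- 1 / q)"
    have "\<delta> powr q = real k powr (- 1)" using q by (simp add: \<delta>_def powr_powr)
    then have \<delta>: "0 < \<delta>" "real k * \<delta> powr q \<le> 1"
      using k by (auto simp: \<delta>_def powr_minus)
    have bound: "\<alpha> * ln (real n) powr \<theta> \<le> D"
      if tri: "\<forall>x\<in>Y. \<forall>y\<in>Y. \<forall>z\<in>Y. dY x z \<le> dY x y + dY y z" and dia: "diamond_convex Y dY \<kappa> p"
        and D: "1 \<le> D" and emb: "bi_Lipschitz_embedding L (lq_dist q) Y dY D f"
      for Y :: "'b set" and dY D f
    proof -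
      have "\<beta> * real k powr \<theta> \<le> D"
      proof (cases "k = 1")
        case True
        then show ?thesis using D by (simp add: \<beta>_def)
      next
        case False
        obtain r where "f ` L \<subseteq> Y" "r > 0" "\<And>x y. x \<in> L \<Longrightarrow> y \<in> L \<Longrightarrow> r * lq_dist q x y \<le> dY (f x) (f y)"
          "\<And>x y. x \<in> L \<Longrightarrow> y \<in> L \<Longrightarrow> dY (f x) (f y) \<le> r * D * lq_dist q x y"
          using emb unfolding bi_Lipschitz_embedding_def by blast
        then have "real k * \<kappa> * (\<delta> / D) powr p \<le> 2"
          using grid False \<kappa> p tri D
          by (intro laakso_grid_embedding_bound[OF q \<delta> _ dia, of L f r]) (auto simp: \<delta>_def)
        then have "real k * \<kappa> * \<delta> powr p \<le> 2 * D powr p"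
          using D \<delta> by (simp add: powr_divide field_simps)
        then have "(\<kappa> / 2) * (real k * \<delta> powr p) \<le> D powr p" by (simp add: mult_ac)
        then have "((\<kappa> / 2) * (real k * \<delta> powr p)) powr (1 / p) \<le> (D powr p) powr (1 / p)"
          by (intro powr_mono2) (use p \<kappa> in auto)
        also have "(D powr p) powr (1 / p) = D" using D p by (simp add: powr_powr)
        also have "((\<kappa> / 2) * (real k * \<delta> powr p)) powr (1 / p) = (\<kappa> / 2) powr (1 / p) * real k powr \<theta>"
        proof -
          have "real k * \<delta> powr p = real k powr 1 * real k powr (- p / q)"
            using k by (simp add: \<delta>_def powr_powr)
          also have "\<dots> = real k powr (1 - p / q)" by (simp only: powr_add[symmetric]) simp
          finally have "real k * \<delta> powr p = real k powr (1 - p / q)" .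
          moreover have "(1 - p / q) * (1 / p) = \<theta>" using p by (simp add: \<theta>_def field_simps)
          ultimately show ?thesis using \<kappa> by (simp only: powr_mult powr_powr)
        qed
        finally have "(\<kappa> / 2) powr (1 / p) * real k powr \<theta> \<le> D" .
        moreover have "\<beta> * real k powr \<theta> \<le> (\<kappa> / 2) powr (1 / p) * real k powr \<theta>"
          by (rule mult_right_mono) (auto simp: \<beta>_def)
        ultimately show ?thesis by simp
      qed
      moreover have "ln (real n) powr \<theta> \<le> (7 * real k) powr \<theta>"
        by (rule powr_mono2) (use \<theta> n k in auto)
      then have "\<alpha> * ln (real n) powr \<theta> \<le> \<alpha> * (7 * real k) powr \<theta>"
        by (rule mult_left_mono) (use \<beta> in \<open>simp add: \<alpha>_def\<close>)
      moreover have "\<alpha> * (7 * real k) powr \<theta> = \<beta> * real k powr \<theta>"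
        by (simp add: \<alpha>_def powr_mult powr_minus)
      ultimately show ?thesis by simp
    qed
    have "L \<subseteq> lq q" using L laakso_set_support finite_support_in_lq by blast
    moreover have "doubling (2 ^ 32) L (lq_dist q)"
      by (rule doubling_subset_laakso_set[OF q \<delta>]) (use L in \<open>auto simp: \<delta>_def\<close>)
    moreover have "distorts TYPE('b) q \<kappa> p L (\<alpha> * ln (real n) powr (1 / p - 1 / q))"
      unfolding distorts_def \<theta>_def[symmetric] by (intro allI impI, elim conjE) (rule bound)
    ultimately show "\<exists>L. L \<subseteq> lq q \<and> finite L \<and> card L = n \<and> doubling (2 ^ 32) L (lq_dist q) \<and>
      distorts TYPE('b) q \<kappa> p L (\<alpha> * ln (real n) powr (1 / p - 1 / q))"
      using L by blast
  qed
qed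

text \<open>The Euclidean norm lies between the \<open>q\<close>-norm and
  \<open>d powr (1 / 2 - 1 / q)\<close> times it. The scale \<open>r\<close> therefore stays and
  only the upper bound loses.\<close>

lemma bi_Lipschitz_embedding_lq_fin_L2:
  assumes q: "2 \<le> q" and d: "1 \<le> d"
    and emb: "bi_Lipschitz_embedding X dX (lq_fin d) (lq_fin_dist q d) D f"
  shows "bi_Lipschitz_embedding X dX (lq_fin d) (\<lambda>x y. L2_set (\<lambda>i. x i - y i) {..<d})
    (D * real d powr (1 / 2 - 1 / q)) f"
proof -
  let ?e = "real d powr (1 / 2 - 1 / q)"
  obtain r where r: "f ` X \<subseteq> lq_fin d" "r > 0"
    "\<And>x y. x \<in> X \<Longrightarrow> y \<in> X \<Longrightarrow> r * dX x y \<le> lq_fin_dist q d (f x) (f y) \<and> lq_fin_dist q d (f x) (f y) \<le> r * D * dX x y"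
    using emb unfolding bi_Lipschitz_embedding_def by blast
  have lower: "lq_fin_dist q d u v \<le> L2_set (\<lambda>i. u i - v i) {..<d}" for u v
    unfolding lq_fin_dist_def lq_fin_norm_def by (rule lq_sum_le_L2_set) (use q in auto)
  have upper: "L2_set (\<lambda>i. u i - v i) {..<d} \<le> ?e * lq_fin_dist q d u v" for u v
    using L2_set_le_lq_sum[of q "{..<d}" "\<lambda>i. u i - v i"] q d
    by (simp add: lq_fin_dist_def lq_fin_norm_def lessThan_empty_iff)
  have "r * dX x y \<le> L2_set (\<lambda>i. f x i - f y i) {..<d} \<and>
     L2_set (\<lambda>i. f x i - f y i) {..<d} \<le> r * (D * ?e) * dX x y" if "x \<in> X" "y \<in> X" for x y
  proof
    show "r * dX x y \<le> L2_set (\<lambda>i. f x i - f y i) {..<d}"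
      using r(3)[OF that] lower[of "f x" "f y"] by linarith
    have "L2_set (\<lambda>i. f x i - f y i) {..<d} \<le> ?e * lq_fin_dist q d (f x) (f y)" by (rule upper)
    also have "\<dots> \<le> ?e * (r * D * dX x y)" by (rule mult_left_mono) (use r(3)[OF that] in auto)
    finally show "L2_set (\<lambda>i. f x i - f y i) {..<d} \<le> r * (D * ?e) * dX x y" by (simp add: mult_ac)
  qed
  then show ?thesis unfolding bi_Lipschitz_embedding_def using r(1,2) by blast
qed

section \<open>The lower bounds for uniformly convex targets and for \<open>lq_fin d\<close>\<close>

theorem corollary2:
  fixes q :: real
  assumes "2 < q"
  shows
    "(\<forall>p::real. 2 \<le> p \<and> p < q \<and> uniformly_convex p TYPE('a::banach) \<longrightarrow>
       (\<exists>\<alpha>>0. \<forall>D\<ge>1. \<forall>n\<ge>1. \<exists>L. L \<subseteq> lq q \<and> finite L \<and> card L = n \<and>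
          doubling (2 ^ 32) L (lq_dist q) \<and>
          ((\<exists>f. bi_Lipschitz_embedding L (lq_dist q) (UNIV :: 'a set) dist D f) \<longrightarrow>
            D \<ge> \<alpha> * ln (real n) powr (1 / p - 1 / q)))) \<and>
     (\<exists>\<alpha>>0. \<forall>d\<ge>1. \<forall>D\<ge>1. \<forall>n\<ge>1. \<exists>L. L \<subseteq> lq q \<and> finite L \<and> card L = n \<and>
          doubling (2 ^ 32) L (lq_dist q) \<and>
          ((\<exists>f. bi_Lipschitz_embedding L (lq_dist q) (lq_fin d) (lq_fin_dist q d) D f) \<longrightarrow>
            D \<ge> \<alpha> * (ln (real n) / real d) powr (1 / 2 - 1 / q)))"
proof (intro conjI allI impI)
  fix p :: real assume *: "2 \<le> p \<and> p < q \<and> uniformly_convex p TYPE('a)"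
  then have p: "1 \<le> p" "p < q" by auto
  obtain \<kappa> where \<kappa>: "0 < \<kappa>" "diamond_convex (UNIV :: 'a set) dist \<kappa> p"
    using diamond_convex_uniformly_convex[of p] * p by blast
  obtain \<alpha> where \<alpha>: "\<alpha> > 0" and main:
    "\<And>n. 1 \<le> n \<Longrightarrow> \<exists>L. L \<subseteq> lq q \<and> finite L \<and> card L = n \<and> doubling (2 ^ 32) L (lq_dist q) \<and>
      distorts TYPE('a) q \<kappa> p L (\<alpha> * ln (real n) powr (1 / p - 1 / q))"
    using laakso_sample_distortion[OF p \<kappa>(1), where 'b='a] by blast
  have sample: "\<exists>L. L \<subseteq> lq q \<and> finite L \<and> card L = n \<and> doubling (2 ^ 32) L (lq_dist q) \<and>
          ((\<exists>f. bi_Lipschitz_embedding L (lq_dist q) (UNIV :: 'a set) dist D f) \<longrightarrow>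
            D \<ge> \<alpha> * ln (real n) powr (1 / p - 1 / q))"
    if D: "1 \<le> D" and n: "1 \<le> n" for n :: nat and D :: real
  proof -
    obtain L where L: "L \<subseteq> lq q" "finite L" "card L = n" "doubling (2 ^ 32) L (lq_dist q)"
      and hard: "distorts TYPE('a) q \<kappa> p L (\<alpha> * ln (real n) powr (1 / p - 1 / q))"
      using main[OF n] by blast
    have "\<alpha> * ln (real n) powr (1 / p - 1 / q) \<le> D"
      if "bi_Lipschitz_embedding L (lq_dist q) (UNIV :: 'a set) dist D f" for f
      by (rule distortsD[OF hard _ \<kappa>(2) D that]) (rule dist_triangle)
    then show ?thesis using L by blast
  qed
  show "\<exists>\<alpha>>0. \<forall>D\<ge>1. \<forall>n\<ge>1. \<exists>L. L \<subseteq> lq q \<and> finite L \<and> card L = n \<and>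
          doubling (2 ^ 32) L (lq_dist q) \<and>
          ((\<exists>f. bi_Lipschitz_embedding L (lq_dist q) (UNIV :: 'a set) dist D f) \<longrightarrow>
            D \<ge> \<alpha> * ln (real n) powr (1 / p - 1 / q))"
    by (intro exI[of _ \<alpha>] conjI allI impI \<alpha> sample)
next
  \<comment> \<open>Euclidean diamonds have exponent 2 and constant \<open>1 / 8\<close> in every
    dimension, so \<open>\<alpha>\<close> is fixed before \<open>d\<close>.\<close>
  have p: "(1::real) \<le> 2" and eighth: "0 < (1 / 8 :: real)" by simp_all
  obtain \<alpha> where \<alpha>: "\<alpha> > 0" and main:
    "\<And>n. 1 \<le> n \<Longrightarrow> \<exists>L. L \<subseteq> lq q \<and> finite L \<and> card L = n \<and> doubling (2 ^ 32) L (lq_dist q) \<and>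
      distorts TYPE(nat \<Rightarrow> real) q (1 / 8) 2 L (\<alpha> * ln (real n) powr (1 / 2 - 1 / q))"
    using laakso_sample_distortion[OF p assms eighth, where 'b="nat \<Rightarrow> real"] by blast
  have sample: "\<exists>L. L \<subseteq> lq q \<and> finite L \<and> card L = n \<and> doubling (2 ^ 32) L (lq_dist q) \<and>
          ((\<exists>f. bi_Lipschitz_embedding L (lq_dist q) (lq_fin d) (lq_fin_dist q d) D f) \<longrightarrow>
            D \<ge> \<alpha> * (ln (real n) / real d) powr (1 / 2 - 1 / q))"
    if d: "1 \<le> d" and D: "1 \<le> D" and n: "1 \<le> n" for d n :: nat and D :: real
  proof -
    let ?e = "real d powr (1 / 2 - 1 / q)" and ?d2 = "\<lambda>x y. L2_set (\<lambda>i. x i - y i) {..<d}"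
    obtain L where L: "L \<subseteq> lq q" "finite L" "card L = n" "doubling (2 ^ 32) L (lq_dist q)"
      and hard: "distorts TYPE(nat \<Rightarrow> real) q (1 / 8) 2 L (\<alpha> * ln (real n) powr (1 / 2 - 1 / q))"
      using main[OF n] by blast
    have e: "1 \<le> ?e" by (rule ge_one_powr_ge_zero) (use d assms in \<open>auto simp: field_simps\<close>)
    have "\<alpha> * (ln (real n) / real d) powr (1 / 2 - 1 / q) \<le> D"
      if emb: "bi_Lipschitz_embedding L (lq_dist q) (lq_fin d) (lq_fin_dist q d) D f" for f
    proof -
      have "\<alpha> * ln (real n) powr (1 / 2 - 1 / q) \<le> D * ?e"
      proof (rule distortsD[OF hard])
        show "?d2 x z \<le> ?d2 x y + ?d2 y z" for x y z
          using L2_set_triangle_ineq[of "\<lambda>i. x i - y i" "\<lambda>i. y i - z i" "{..<d}"] by simp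
        show "diamond_convex (lq_fin d) ?d2 (1 / 8) 2" by (rule diamond_convex_L2_set) simp
        show "1 \<le> D * ?e" using mult_mono[OF D e] D by simp
        show "bi_Lipschitz_embedding L (lq_dist q) (lq_fin d) ?d2 (D * ?e) f"
          by (rule bi_Lipschitz_embedding_lq_fin_L2[OF _ d emb]) (use assms in simp)
      qed
      \<comment> \<open>Dividing by \<open>?e\<close> moves \<open>d\<close> under the logarithm,
        since both powers have the same exponent.\<close>
      then show ?thesis using n d e by (simp add: powr_divide field_simps)
    qed
    then show ?thesis using L by blast
  qed
  show "\<exists>\<alpha>>0. \<forall>d\<ge>1. \<forall>D\<ge>1. \<forall>n\<ge>1. \<exists>L. L \<subseteq> lq q \<and> finite L \<and> card L = n \<and>
          doubling (2 ^ 32) L (lq_dist q) \<and>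
          ((\<exists>f. bi_Lipschitz_embedding L (lq_dist q) (lq_fin d) (lq_fin_dist q d) D f) \<longrightarrow>
            D \<ge> \<alpha> * (ln (real n) / real d) powr (1 / 2 - 1 / q))"
    by (intro exI[of _ \<alpha>] conjI allI impI \<alpha> sample)
qed

end
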